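(* Let $\Bbbk$ be a field of characteristic $0$ and $n\ge3$. Let $\Omega\in\Bbbk[t_1,\dots,t_{n+1}]$ be an i.s. potential of degree $n+1+d_0$ with $d_0\ge2$. Let $N$ be the Nambu-Poisson fraction field of $P_{\Omega-\xi}$ where $\xi\in\Bbbk^\times$, and let $K$ be another ($n$-Lie) Nambu-Poisson field of GK-dimension $n$. (1) If $\mathcal V_0(K)\ne\emptyset$, then there is no Nambu-Poisson algebra morphism from $N$ to $K$. (2) If $K$ is either $N_q$ (with $q\in\Bbbk^\times$), or $N_{Weyl}$, or $Q(P_{\Omega_0})$ where $\Omega_0\in\Bbbk[t_1,\dots,t_{n+1}]$ is homogeneous of degree $n+1$ (with $P_{\Omega_0}$ a domain), then there is no Nambu-Poisson algebra morphism from $N$ to $K$.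
   Context: A Nambu-Poisson algebra ($n$-Lie Poisson algebra) is a commutative $\Bbbk$-algebra $P$ with an $n$-ary $\Bbbk$-multilinear bracket $\{-,\dots,-\}$ that vanishes whenever two arguments are equal, satisfies $\{\{u_1,\dots,u_n\},v_1,\dots,v_{n-1}\}=\sum_{s=1}^n\{u_1,\dots,u_{s-1},\{u_s,v_1,\dots,v_{n-1}\},u_{s+1},\dots,u_n\}$, and satisfies the Leibniz rule in each argument. The bracket of a Nambu-Poisson domain $A$ extends uniquely to its fraction field $Q(A)$. Morphisms are (unital) $\Bbbk$-algebra maps preserving brackets. GK-dimension of a field over $\Bbbk$ equals its transcendence degree over $\Bbbk$. $N_q$ is $\Bbbk(t_1,\dots,t_n)$ with $\{t_1,\dots,t_n\}=q\,t_1\cdots t_n$; $N_{Weyl}$ is $\Bbbk(t_1,\dots,t_n)$ with $\{t_1,\dots,t_n\}=1$. A $0$-valuation on a Nambu-Poisson field $K$ is a map $\nu:K\to\mathbb Z\cup\{\infty\}$ such that for all $a,b,b_i\in K$: $\nu(a)=\infty$ iff $a=0$; $\nu(c)=0$ for $c\in\Bbbk^\times$; $\nu(ab)=\nu(a)+\nu(b)$; $\nu(a+b)\ge\min\{\nu(a),\nu(b)\}$ with equality if $\nu(a)\ne\nu(b)$; and $\nu(\{b_1,\dots,b_n\})\ge\sum_{s=1}^n\nu(b_s)$. It is trivial if $\nu(a)=0$ for all $a\ne0$. $\mathcal V_0(K)$ is the set of nontrivial $0$-valuations on $K$. An i.s. potential is a homogeneous element $\Omega\in\Bbbk[t_1,\dots,t_{n+1}]$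 (with $\deg t_i=1$ for all $i$) such that $\Bbbk[t_1,\dots,t_{n+1}]/(\Omega_{t_1},\dots,\Omega_{t_{n+1}})$ is finite-dimensional over $\Bbbk$, where $\Omega_{t_i}=\partial\Omega/\partial t_i$. For $\Omega\in\Bbbk[t_1,\dots,t_{n+1}]$, $A_\Omega$ is $\Bbbk[t_1,\dots,t_{n+1}]$ with bracket $\{f_1,\dots,f_n\}=\det\frac{\partial(f_1,\dots,f_n,\Omega)}{\partial(t_1,\dots,t_{n+1})}$; for $\xi\in\Bbbk$, $P_{\Omega-\xi}=A_\Omega/(\Omega-\xi)$ with the induced bracket, and $P_\Omega=P_{\Omega-0}$. *)

theory Defs
  imports
    "HOL-Library.Poly_Mapping"
    "HOL-Library.Extended_Real"
    "HOL-Library.Liminf_Limsup"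
    Complex_Main
    "Jordan_Normal_Form.Determinant"
begin

section \<open>Polynomials in finitely many variables\<close>

text \<open>
  Polynomials have exponent vectors indexed by all of \<open>nat\<close>; the ring
  \<open>k[t\<^sub>1, \<dots>, t\<^sub>m]\<close> is the subring \<open>poly_ring m\<close>, and \<open>t\<^sub>i\<close> is \<open>pvar (i - 1)\<close>.
\<close>

type_synonym 'k mpoly = "(nat \<Rightarrow>\<^sub>0 nat) \<Rightarrow>\<^sub>0 'k"

definition poly_ring :: "nat \<Rightarrow> 'k::field mpoly set" where
  "poly_ring m = {p. \<forall>e\<in>Poly_Mapping.keys p. Poly_Mapping.keys e \<subseteq> {..<m}}"

definition pconst :: "'k \<Rightarrow> 'k::field mpoly" where
  "pconst c = Poly_Mapping.single 0 c"

definition pvar :: "nat \<Rightarrow> 'k::field mpoly" where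
  "pvar i = Poly_Mapping.single (Poly_Mapping.single i 1) 1"

text \<open>
  In the summand, the subtraction of exponents is truncated only if the exponent of the
  variable is \<open>0\<close>, and then the coefficient is \<open>0\<close>.
\<close>

definition pderivative :: "nat \<Rightarrow> 'k::field mpoly \<Rightarrow> 'k mpoly" where
  "pderivative i p = (\<Sum>e\<in>Poly_Mapping.keys p.
     Poly_Mapping.single (e - Poly_Mapping.single i 1)
       (of_nat (Poly_Mapping.lookup e i) * Poly_Mapping.lookup p e))"

definition homogeneous_of_degree :: "nat \<Rightarrow> 'k::field mpoly \<Rightarrow> bool" where
  "homogeneous_of_degree d p \<longleftrightarrow> p \<noteq> 0 \<and>
     (\<forall>e\<in>Poly_Mapping.keys p. (\<Sum>i\<in>Poly_Mapping.keys e. Poly_Mapping.lookup e i) = d)"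

definition principal_ideal :: "nat \<Rightarrow> 'k::field mpoly \<Rightarrow> 'k mpoly set" where
  "principal_ideal m g = {h * g | h. h \<in> poly_ring m}"

definition gradient_ideal :: "nat \<Rightarrow> 'k::field mpoly \<Rightarrow> 'k mpoly set" where
  "gradient_ideal m \<Omega> = {\<Sum>i<m. h i * pderivative i \<Omega> | h. \<forall>i<m. h i \<in> poly_ring m}"

text \<open>
  The last conjunct says that the quotient of \<open>poly_ring m\<close> by the ideal of the partial
  derivatives is spanned by the classes of finitely many elements \<open>B\<close>.
\<close>

definition is_potential :: "nat \<Rightarrow> 'k::field mpoly \<Rightarrow> bool" where
  "is_potential m \<Omega> \<longleftrightarrow> \<Omega> \<in> poly_ring m \<and> (\<exists>d. homogeneous_of_degree d \<Omega>) \<and>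
     (\<exists>B. finite B \<and> B \<subseteq> poly_ring m \<and>
        (\<forall>f\<in>poly_ring m. \<exists>c. f - (\<Sum>b\<in>B. pconst (c b) * b) \<in> gradient_ideal m \<Omega>))"

text \<open>The bracket of \<open>A\<^sub>\<Omega>\<close>, on lists \<open>fs\<close> of length \<open>n\<close>.\<close>

definition jacobian_bracket :: "nat \<Rightarrow> 'k::field mpoly \<Rightarrow> 'k mpoly list \<Rightarrow> 'k mpoly" where
  "jacobian_bracket n \<Omega> fs =
     det (mat (n + 1) (n + 1) (\<lambda>(i, j). pderivative j ((fs @ [\<Omega>]) ! i)))"


section \<open>Commutative algebras and GK-dimension\<close>

locale comm_algebra = vector_space scale
  for scale :: "'k::field \<Rightarrow> 'a::comm_ring_1 \<Rightarrow> 'a" +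
  assumes scale_mult: "scale c (x * y) = scale c x * y"
begin

text \<open>
  For a finite-dimensional subspace \<open>V\<close> spanned by the finite set \<open>S\<close>,
  \<open>growth_space S m\<close> is \<open>V\<^sup>0 + V\<^sup>1 + \<dots> + V\<^sup>m\<close>.
\<close>

definition growth_space :: "'a set \<Rightarrow> nat \<Rightarrow> 'a set" where
  "growth_space S m = span {prod_list xs | xs. set xs \<subseteq> S \<and> length xs \<le> m}"

definition GKdim :: ereal where
  "GKdim = (SUP S\<in>{S. finite S}.
     limsup (\<lambda>m. ereal (ln (real (dim (growth_space S m))) / ln (real m))))"

end


section \<open>Nambu-Poisson algebras\<close>

text \<open>The bracket is only relevant on lists of length \<open>n\<close>.\<close>

locale nambu_poisson_algebra = comm_algebra scale
  for scale :: "'k::field \<Rightarrow> 'a::comm_ring_1 \<Rightarrow> 'a" +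
  fixes n :: nat
    and br :: "'a list \<Rightarrow> 'a"
  assumes br_add: "\<lbrakk>length us = n; s < n\<rbrakk> \<Longrightarrow>
      br (us[s := x + y]) = br (us[s := x]) + br (us[s := y])"
    and br_scale: "\<lbrakk>length us = n; s < n\<rbrakk> \<Longrightarrow>
      br (us[s := scale c x]) = scale c (br (us[s := x]))"
    and br_alternating: "\<lbrakk>length us = n; i < n; j < n; i \<noteq> j; us ! i = us ! j\<rbrakk> \<Longrightarrow> br us = 0"
    and br_fundamental: "\<lbrakk>length us = n; length vs = n - 1\<rbrakk> \<Longrightarrow>
      br (br us # vs) = (\<Sum>s<n. br (us[s := br (us ! s # vs)]))"
    and br_Leibniz: "\<lbrakk>length us = n; s < n\<rbrakk> \<Longrightarrow>
      br (us[s := x * y]) = x * br (us[s := y]) + br (us[s := x]) * y"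

definition nambu_poisson_morphism ::
    "nat \<Rightarrow> ('k::field \<Rightarrow> 'a::comm_ring_1 \<Rightarrow> 'a) \<Rightarrow> ('a list \<Rightarrow> 'a) \<Rightarrow>
     ('k \<Rightarrow> 'b::comm_ring_1 \<Rightarrow> 'b) \<Rightarrow> ('b list \<Rightarrow> 'b) \<Rightarrow> ('a \<Rightarrow> 'b) \<Rightarrow> bool" where
  "nambu_poisson_morphism n scaleA brA scaleB brB \<theta> \<longleftrightarrow>
     \<theta> 1 = 1 \<and>
     (\<forall>x y. \<theta> (x + y) = \<theta> x + \<theta> y) \<and>
     (\<forall>x y. \<theta> (x * y) = \<theta> x * \<theta> y) \<and>
     (\<forall>c x. \<theta> (scaleA c x) = scaleB c (\<theta> x)) \<and>
     (\<forall>us. length us = n \<longrightarrow> \<theta> (brA us) = brB (map \<theta> us))"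

text \<open>Values in \<open>\<int> \<union> {\<infinity>}\<close> are represented in \<open>ereal\<close>.\<close>

definition zero_valuation ::
    "nat \<Rightarrow> ('k::field \<Rightarrow> 'a::field \<Rightarrow> 'a) \<Rightarrow> ('a list \<Rightarrow> 'a) \<Rightarrow> ('a \<Rightarrow> ereal) \<Rightarrow> bool" where
  "zero_valuation n scale br \<nu> \<longleftrightarrow>
     (\<forall>a. \<nu> a \<in> insert \<infinity> (range (\<lambda>z::int. ereal (real_of_int z)))) \<and>
     (\<forall>a. \<nu> a = \<infinity> \<longleftrightarrow> a = 0) \<and>
     (\<forall>c. c \<noteq> 0 \<longrightarrow> \<nu> (scale c 1) = 0) \<and>
     (\<forall>a b. \<nu> (a * b) = \<nu> a + \<nu> b) \<and>
     (\<forall>a b. \<nu> (a + b) \<ge> min (\<nu> a) (\<nu> b)) \<and>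
     (\<forall>a b. \<nu> a \<noteq> \<nu> b \<longrightarrow> \<nu> (a + b) = min (\<nu> a) (\<nu> b)) \<and>
     (\<forall>bs. length bs = n \<longrightarrow> \<nu> (br bs) \<ge> sum_list (map \<nu> bs))"

definition trivial_valuation :: "('a::field \<Rightarrow> ereal) \<Rightarrow> bool" where
  "trivial_valuation \<nu> \<longleftrightarrow> (\<forall>a. a \<noteq> 0 \<longrightarrow> \<nu> a = 0)"

definition nontrivial_zero_valuations ::
    "nat \<Rightarrow> ('k::field \<Rightarrow> 'a::field \<Rightarrow> 'a) \<Rightarrow> ('a list \<Rightarrow> 'a) \<Rightarrow> ('a \<Rightarrow> ereal) set" where
  "nontrivial_zero_valuations n scale br =
     {\<nu>. zero_valuation n scale br \<nu> \<and> \<not> trivial_valuation \<nu>}"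


section \<open>The fields in question\<close>

text \<open>
  \<open>fraction_field_via m I scale \<pi>\<close>: the field \<open>'a\<close> is the fraction field of
  \<open>poly_ring m / I\<close>. The quotient is embedded as the image of \<open>\<pi>\<close>, whose kernel is \<open>I\<close>;
  in particular the quotient is a domain. Only the values of \<open>\<pi>\<close> on \<open>poly_ring m\<close> matter.
\<close>

definition fraction_field_via ::
    "nat \<Rightarrow> 'k::field mpoly set \<Rightarrow> ('k \<Rightarrow> 'a::field \<Rightarrow> 'a) \<Rightarrow> ('k mpoly \<Rightarrow> 'a) \<Rightarrow> bool" where
  "fraction_field_via m I scale \<pi> \<longleftrightarrow>
     \<pi> 1 = 1 \<and>
     (\<forall>f\<in>poly_ring m. \<forall>g\<in>poly_ring m. \<pi> (f + g) = \<pi> f + \<pi> g) \<and>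
     (\<forall>f\<in>poly_ring m. \<forall>g\<in>poly_ring m. \<pi> (f * g) = \<pi> f * \<pi> g) \<and>
     (\<forall>c. \<forall>f\<in>poly_ring m. \<pi> (pconst c * f) = scale c (\<pi> f)) \<and>
     (\<forall>f\<in>poly_ring m. \<pi> f = 0 \<longleftrightarrow> f \<in> I) \<and>
     (\<forall>x. \<exists>f\<in>poly_ring m. \<exists>g\<in>poly_ring m. \<pi> g \<noteq> 0 \<and> x = \<pi> f / \<pi> g)"

text \<open>
  The Nambu-Poisson fraction field of \<open>P\<^bsub>\<Omega>-\<xi>\<^esub> = A\<^sub>\<Omega> / (\<Omega> - \<xi>)\<close>: its bracket is the (unique)
  Nambu-Poisson bracket that extends the one induced on the quotient.
\<close>

definition is_Q_P ::
    "nat \<Rightarrow> 'k::field mpoly \<Rightarrow> 'k \<Rightarrow> ('k \<Rightarrow> 'a::field \<Rightarrow> 'a) \<Rightarrow> ('a list \<Rightarrow> 'a) \<Rightarrow> bool" where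
  "is_Q_P n \<Omega> \<xi> scale br \<longleftrightarrow>
     nambu_poisson_algebra scale n br \<and>
     (\<exists>\<pi>. fraction_field_via (n + 1) (principal_ideal (n + 1) (\<Omega> - pconst \<xi>)) scale \<pi> \<and>
        (\<forall>fs. length fs = n \<and> set fs \<subseteq> poly_ring (n + 1) \<longrightarrow>
           br (map \<pi> fs) = \<pi> (jacobian_bracket n \<Omega> fs)))"

definition is_N_q ::
    "nat \<Rightarrow> 'k::field \<Rightarrow> ('k \<Rightarrow> 'a::field \<Rightarrow> 'a) \<Rightarrow> ('a list \<Rightarrow> 'a) \<Rightarrow> bool" where
  "is_N_q n q scale br \<longleftrightarrow>
     nambu_poisson_algebra scale n br \<and>
     (\<exists>\<pi>. fraction_field_via n {0} scale \<pi> \<and>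
        br (map (\<lambda>i. \<pi> (pvar i)) [0..<n]) = scale q (\<Prod>i<n. \<pi> (pvar i)))"

definition is_N_Weyl ::
    "nat \<Rightarrow> ('k::field \<Rightarrow> 'a::field \<Rightarrow> 'a) \<Rightarrow> ('a list \<Rightarrow> 'a) \<Rightarrow> bool" where
  "is_N_Weyl n scale br \<longleftrightarrow>
     nambu_poisson_algebra scale n br \<and>
     (\<exists>\<pi>. fraction_field_via n {0} scale \<pi> \<and>
        br (map (\<lambda>i. \<pi> (pvar i)) [0..<n]) = 1)"

end

theory Submission
  imports Defs "HOL-Real_Asymp.Real_Asymp"
begin

text \<open>
  Let \<open>y\<^sub>i \<in> K\<close> be the images of the \<open>t\<^sub>i\<close> under a morphism and let \<open>v\<close> be a nontrivial \<open>0\<close>-valuation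
  on \<open>K\<close>. A power \<open>t\<^sub>i\<^sup>M\<close> is a combination of the \<open>\<Omega>\<^sub>j\<close> with homogeneous coefficients, and
  \<open>v (\<Omega>\<^sub>j (y)) \<ge> n min\<^sub>i v (y\<^sub>i)\<close> because \<open>\<Omega>\<^sub>j (y)\<close> is, up to sign, a bracket of \<open>n\<close> of the \<open>y\<^sub>i\<close>; since
  \<open>deg \<Omega>\<^sub>j = n + d\<^sub>0 > n\<close>, a negative minimum is impossible, so \<open>v (y\<^sub>i) \<ge> 0\<close> for all \<open>i\<close>. By Euler's formula and
  \<open>\<Omega> (y) = \<xi> \<noteq> 0\<close>, some \<open>\<Omega>\<^sub>b (y)\<close> has value \<open>0\<close>. For \<open>G\<close> in the variables other than \<open>t\<^sub>b\<close>, the bracket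
  of \<open>G (y)\<close> with the \<open>y\<^sub>c\<close>, \<open>c \<noteq> a, b\<close>, is \<open>\<plusminus> G\<^sub>a (y) \<Omega>\<^sub>b (y)\<close>, so \<open>v (G (y)) \<le> v (G\<^sub>a (y))\<close>, and induction on the
  degree yields \<open>v (G (y)) = 0\<close> whenever \<open>G \<noteq> 0\<close>. An element \<open>z\<close> with \<open>v (z) \<noteq> 0\<close> is then transcendental over
  the \<open>n\<close> algebraically independent elements \<open>y\<^sub>c\<close>, \<open>c \<noteq> b\<close>, which contradicts the GK-dimension \<open>n\<close> of \<open>K\<close>.

  The fields in the second part are fraction fields of graded domains on which the bracket has
  degree at most \<open>0\<close>, so minus the degree is a nontrivial \<open>0\<close>-valuation on them.
\<close>

section \<open>Polynomials, evaluation and derivations\<close>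

definition monom_degree :: "(nat \<Rightarrow>\<^sub>0 nat) \<Rightarrow> nat" where
  "monom_degree e = (\<Sum>i\<in>Poly_Mapping.keys e. Poly_Mapping.lookup e i)"

lemma monom_degree_superset:
  assumes "finite A" "Poly_Mapping.keys e \<subseteq> A"
  shows "monom_degree e = (\<Sum>i\<in>A. Poly_Mapping.lookup e i)"
  unfolding monom_degree_def
  by (rule sum.mono_neutral_left) (use assms in \<open>auto simp: in_keys_iff\<close>)

lemma monom_degree_zero [simp]: "monom_degree 0 = 0"
  by (simp add: monom_degree_def)

lemma monom_degree_single [simp]: "monom_degree (Poly_Mapping.single i k) = k"
  by (simp add: monom_degree_def)

lemma monom_degree_add: "monom_degree (e + e') = monom_degree e + monom_degree e'"
proof -
  let ?A = "Poly_Mapping.keys e \<union> Poly_Mapping.keys e'"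
  have *: "finite ?A" "Poly_Mapping.keys (e + e') \<subseteq> ?A"
    using Poly_Mapping.keys_add[of e e'] by auto
  show ?thesis
    using monom_degree_superset[OF *] monom_degree_superset[OF *(1), of e]
      monom_degree_superset[OF *(1), of e']
    by (simp add: lookup_add sum.distrib)
qed

lemma homogeneous_of_degree_iff:
  "homogeneous_of_degree d p \<longleftrightarrow> p \<noteq> 0 \<and> (\<forall>e\<in>Poly_Mapping.keys p. monom_degree e = d)"
  by (simp add: homogeneous_of_degree_def monom_degree_def)

lemma poly_mapping_expand:
  fixes p :: "'a \<Rightarrow>\<^sub>0 'b::comm_monoid_add"
  shows "p = (\<Sum>e\<in>Poly_Mapping.keys p. Poly_Mapping.single e (Poly_Mapping.lookup p e))"
proof (rule poly_mapping_eqI)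
  fix k
  show "Poly_Mapping.lookup p k = Poly_Mapping.lookup
      (\<Sum>e\<in>Poly_Mapping.keys p. Poly_Mapping.single e (Poly_Mapping.lookup p e)) k"
    by (auto simp: lookup_sum lookup_single when_def in_keys_iff sum.delta)
qed

text \<open>Both summands in the \<open>add\<close> case keep their support in \<open>S\<close>.
  Conditions such as homogeneity or membership in \<open>poly_ring m\<close> can therefore be
  encoded in \<open>S\<close> and remain available throughout the induction.\<close>

lemma mpoly_induct [consumes 1, case_names single add zero]:
  fixes p :: "'k::field mpoly"
  assumes "Poly_Mapping.keys p \<subseteq> S"
    and single: "\<And>e c. e \<in> S \<Longrightarrow> P (Poly_Mapping.single e c)"
    and add: "\<And>p q. Poly_Mapping.keys p \<subseteq> S \<Longrightarrow> Poly_Mapping.keys q \<subseteq> S \<Longrightarrow> P p \<Longrightarrow> P q \<Longrightarrow> P (p + q)"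
    and zero: "P 0"
  shows "P p"
proof -
  have "P (\<Sum>e\<in>A. Poly_Mapping.single e (Poly_Mapping.lookup p e)) \<and>
      Poly_Mapping.keys (\<Sum>e\<in>A. Poly_Mapping.single e (Poly_Mapping.lookup p e)) \<subseteq> S"
    if "finite A" "A \<subseteq> S" for A
    using that
  proof (induction A rule: finite_induct)
    case empty
    then show ?case using zero by simp
  next
    case (insert e A)
    then show ?case
      by (auto intro!: add single dest!: Poly_Mapping.keys_add[THEN subsetD] split: if_splits)
  qed
  then show ?thesis
    using assms(1) poly_mapping_expand[of p] by (metis finite_keys)
qed

text \<open>One filter on exponents serves for homogeneous components, for truncation by degree, and
  for the parts with a fixed exponent in one variable.\<close>

definition mpart :: "((nat \<Rightarrow>\<^sub>0 nat) \<Rightarrow> bool) \<Rightarrow> 'k::field mpoly \<Rightarrow> 'k mpoly" where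
  "mpart P p = Poly_Mapping.mapp (\<lambda>e c. if P e then c else 0) p"

lemma lookup_mpart:
  "Poly_Mapping.lookup (mpart P p) e = (if P e then Poly_Mapping.lookup p e else 0)"
  by (auto simp: mpart_def lookup_mapp when_def in_keys_iff)

lemma keys_mpart: "Poly_Mapping.keys (mpart P p) = {e \<in> Poly_Mapping.keys p. P e}"
  by (auto simp: in_keys_iff lookup_mpart split: if_splits)

lemma mpart_add: "mpart P (p + q) = mpart P p + mpart P q"
  by (rule poly_mapping_eqI) (simp add: lookup_mpart lookup_add)

lemma mpart_diff: "mpart P (p - q) = mpart P p - mpart P q"
  by (rule poly_mapping_eqI) (simp add: lookup_mpart lookup_minus)

lemma mpart_zero [simp]: "mpart P 0 = 0"
  by (rule poly_mapping_eqI) (simp add: lookup_mpart)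

lemma mpart_sum: "mpart P (sum f A) = (\<Sum>a\<in>A. mpart P (f a))"
  by (induction A rule: infinite_finite_induct) (simp_all add: mpart_add)

lemma mpart_single:
  "mpart P (Poly_Mapping.single e c) = (if P e then Poly_Mapping.single e c else 0)"
  by (rule poly_mapping_eqI) (auto simp: lookup_mpart lookup_single when_def)

abbreviation hpart :: "nat \<Rightarrow> 'k::field mpoly \<Rightarrow> 'k mpoly" where
  "hpart d \<equiv> mpart (\<lambda>e. monom_degree e = d)"

text \<open>Multiplication by a form of degree \<open>d\<close> shifts degrees by \<open>d\<close>.
  The condition is put on the keys because \<open>homogeneous_of_degree\<close> excludes 0, while a
  partial derivative may vanish.\<close>

lemma hpart_mult:
  assumes "\<forall>e\<in>Poly_Mapping.keys g. monom_degree e = d"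
  shows "hpart (k + d) (h * g) = hpart k h * g"
proof -
  have *: "hpart (k + d) (Poly_Mapping.single e c * g) = hpart k (Poly_Mapping.single e c) * g" for e c
  proof (rule mpoly_induct[of g "{e. monom_degree e = d}"])
    show "Poly_Mapping.keys g \<subseteq> {e. monom_degree e = d}"
      using assms by blast
  qed (auto simp: mult_single mpart_single monom_degree_add mpart_add algebra_simps)
  show ?thesis
    by (rule mpoly_induct[of h UNIV]) (auto simp: * mpart_add distrib_right)
qed

lemma hpart_mult_less:
  assumes "\<forall>e\<in>Poly_Mapping.keys g. monom_degree e = d" "k < d"
  shows "hpart k (h * g) = 0"
proof -
  have "e \<notin> Poly_Mapping.keys (hpart k (h * g))" for e
    using keys_mult[of h g] assms by (fastforce simp: keys_mpart monom_degree_add)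
  then show ?thesis
    by (metis all_not_in_conv keys_eq_empty)
qed

lemma sum_hpart:
  assumes "\<forall>e\<in>Poly_Mapping.keys p. monom_degree e \<le> N"
  shows "(\<Sum>d\<le>N. hpart d p) = p"
proof (rule poly_mapping_eqI)
  fix e
  show "Poly_Mapping.lookup (\<Sum>d\<le>N. hpart d p) e = Poly_Mapping.lookup p e"
    using assms by (cases "e \<in> Poly_Mapping.keys p") (auto simp: lookup_sum lookup_mpart in_keys_iff)
qed

section \<open>The subring of polynomials in the first \<open>m\<close> variables\<close>

lemma poly_ring_iff_keys: "p \<in> poly_ring m \<longleftrightarrow> Poly_Mapping.keys p \<subseteq> {e. Poly_Mapping.keys e \<subseteq> {..<m}}"
  by (auto simp: poly_ring_def)

lemma poly_ring_zero [simp]: "0 \<in> poly_ring m"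
  by (simp add: poly_ring_def)

lemma poly_ring_one [simp]: "1 \<in> poly_ring m"
  by (simp add: poly_ring_def)

lemma poly_ring_pconst [simp]: "pconst c \<in> poly_ring m"
  by (simp add: poly_ring_def pconst_def)

lemma poly_ring_pvar [simp]: "pvar i \<in> poly_ring m \<longleftrightarrow> i < m"
  by (simp add: poly_ring_def pvar_def)

lemma poly_ring_single: "Poly_Mapping.keys e \<subseteq> {..<m} \<Longrightarrow> Poly_Mapping.single e c \<in> poly_ring m"
  by (simp add: poly_ring_def)

lemma poly_ring_add: "p \<in> poly_ring m \<Longrightarrow> q \<in> poly_ring m \<Longrightarrow> p + q \<in> poly_ring m"
  using Poly_Mapping.keys_add[of p q] by (auto simp: poly_ring_def)

lemma poly_ring_diff: "p \<in> poly_ring m \<Longrightarrow> q \<in> poly_ring m \<Longrightarrow> p - q \<in> poly_ring m"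
  using poly_ring_add[of p m "- q"] by (simp add: poly_ring_def)

lemma poly_ring_uminus: "p \<in> poly_ring m \<Longrightarrow> - p \<in> poly_ring m"
  using poly_ring_diff[of 0 m p] by simp

lemma poly_ring_mult:
  assumes "p \<in> poly_ring m" "q \<in> poly_ring m"
  shows "p * q \<in> poly_ring m"
proof -
  have "Poly_Mapping.keys (a + b) \<subseteq> {..<m}"
    if "a \<in> Poly_Mapping.keys p" "b \<in> Poly_Mapping.keys q" for a b
    using assms that Poly_Mapping.keys_add[of a b] by (fastforce simp: poly_ring_def)
  then show ?thesis
    using keys_mult[of p q] by (fastforce simp: poly_ring_def)
qed

lemma poly_ring_sum: "(\<And>i. i \<in> A \<Longrightarrow> f i \<in> poly_ring m) \<Longrightarrow> sum f A \<in> poly_ring m"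
  by (induction A rule: infinite_finite_induct) (auto simp: poly_ring_add)

lemma poly_ring_prod: "(\<And>i. i \<in> A \<Longrightarrow> f i \<in> poly_ring m) \<Longrightarrow> prod f A \<in> poly_ring m"
  by (induction A rule: infinite_finite_induct) (auto simp: poly_ring_mult)

lemma poly_ring_power: "p \<in> poly_ring m \<Longrightarrow> p ^ k \<in> poly_ring m"
  by (induction k) (auto simp: poly_ring_mult)

lemma poly_ring_mpart: "p \<in> poly_ring m \<Longrightarrow> mpart P p \<in> poly_ring m"
  by (auto simp: poly_ring_def keys_mpart)

section \<open>Partial derivatives\<close>

lemma add_diff_single:
  assumes "0 < Poly_Mapping.lookup e i"
  shows "(e - Poly_Mapping.single i 1) + Poly_Mapping.single i (1::nat) = e"
  by (rule poly_mapping_eqI)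
    (use assms in \<open>auto simp: lookup_add lookup_minus lookup_single when_def\<close>)

text \<open>Lowering the exponent at \<open>i\<close> by one is injective on the exponent vectors
  where it is positive. Where it is 0, the truncated subtraction does no harm because the
  coefficient has the factor 0.\<close>

lemma lookup_pderivative:
  "Poly_Mapping.lookup (pderivative i p) e =
     of_nat (Poly_Mapping.lookup e i + 1) * Poly_Mapping.lookup p (e + Poly_Mapping.single i 1)"
proof -
  let ?e = "e + Poly_Mapping.single i 1"
  have "(if e' - Poly_Mapping.single i 1 = e
          then of_nat (Poly_Mapping.lookup e' i) * Poly_Mapping.lookup p e' else 0) =
        (if e' = ?e then of_nat (Poly_Mapping.lookup e' i) * Poly_Mapping.lookup p e' else 0)" for e'
    using add_diff_single[of e' i] by (cases "Poly_Mapping.lookup e' i = 0") auto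
  then have "Poly_Mapping.lookup (pderivative i p) e =
      (\<Sum>e'\<in>Poly_Mapping.keys p. if e' = ?e
         then of_nat (Poly_Mapping.lookup e' i) * Poly_Mapping.lookup p e' else 0)"
    by (simp add: pderivative_def lookup_sum lookup_single when_def)
  also have "\<dots> = of_nat (Poly_Mapping.lookup ?e i) * Poly_Mapping.lookup p ?e"
    by (simp add: in_keys_iff)
  finally show ?thesis
    by (simp add: lookup_add)
qed

lemma pderivative_add: "pderivative i (p + q) = pderivative i p + pderivative i q"
  by (rule poly_mapping_eqI) (simp add: lookup_pderivative lookup_add algebra_simps)

lemma pderivative_zero [simp]: "pderivative i 0 = 0"
  by (simp add: pderivative_def)

lemma pderivative_single:
  "pderivative i (Poly_Mapping.single e c) =
     Poly_Mapping.single (e - Poly_Mapping.single i 1) (of_nat (Poly_Mapping.lookup e i) * c)"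
  by (cases "c = 0") (simp_all add: pderivative_def)

lemma pderivative_pvar: "pderivative j (pvar i) = (if i = j then 1 else 0)"
  by (auto simp: pvar_def pderivative_single lookup_single when_def)

lemma keys_pderivative:
  "e \<in> Poly_Mapping.keys (pderivative i p) \<Longrightarrow> e + Poly_Mapping.single i 1 \<in> Poly_Mapping.keys p"
  by (auto simp: in_keys_iff lookup_pderivative)

text \<open>Characteristic 0 enters here: a positive exponent, read as an element of the field, is
  not zero.\<close>

lemma pderivative_eq_0D:
  fixes p :: "'k::field_char_0 mpoly"
  assumes "pderivative i p = 0" "e \<in> Poly_Mapping.keys p"
  shows "Poly_Mapping.lookup e i = 0"
proof (rule ccontr)
  assume "Poly_Mapping.lookup e i \<noteq> 0"
  then have "Poly_Mapping.lookup (pderivative i p) (e - Poly_Mapping.single i 1) \<noteq> 0"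
    using assms(2) add_diff_single[of e i]
    by (simp add: lookup_pderivative in_keys_iff del: of_nat_add of_nat_Suc)
  then show False
    using assms(1) by simp
qed

lemma poly_ring_pderivative: "p \<in> poly_ring m \<Longrightarrow> pderivative i p \<in> poly_ring m"
proof -
  assume p: "p \<in> poly_ring m"
  have "Poly_Mapping.keys e \<subseteq> {..<m}" if "e \<in> Poly_Mapping.keys (pderivative i p)" for e
  proof -
    have "Poly_Mapping.keys (e + Poly_Mapping.single i 1) \<subseteq> {..<m}"
      using p keys_pderivative[OF that] by (simp add: poly_ring_def)
    moreover have "Poly_Mapping.keys e \<subseteq> Poly_Mapping.keys (e + Poly_Mapping.single i 1)"
      by (auto simp: in_keys_iff lookup_add)
    ultimately show ?thesis by blast
  qed
  then show ?thesis by (simp add: poly_ring_def)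
qed

lemma homogeneous_pderivative:
  assumes "homogeneous_of_degree (Suc d) p"
  shows "\<forall>e\<in>Poly_Mapping.keys (pderivative i p). monom_degree e = d"
  using assms keys_pderivative[of _ i p] by (force simp: homogeneous_of_degree_iff monom_degree_add)

text \<open>On a monomial with exponent vector \<open>e\<close>, differentiating by a variable and
  multiplying by it again restores the monomial with its exponent as a factor, and these factors sum
  to the degree.\<close>

lemma euler_homogeneous:
  assumes "homogeneous_of_degree d p" "p \<in> poly_ring m"
  shows "(\<Sum>i<m. pvar i * pderivative i p) = pconst (of_nat d) * p"
proof -
  have 1: "pvar i * pderivative i (Poly_Mapping.single e c) =
      Poly_Mapping.single e (of_nat (Poly_Mapping.lookup e i) * c)" for i e and c :: 'a
    using add_diff_single[of e i]
    by (cases "Poly_Mapping.lookup e i = 0") (simp_all add: pderivative_single pvar_def mult_single add.commute)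
  have "Poly_Mapping.keys p \<subseteq> {e. Poly_Mapping.keys e \<subseteq> {..<m} \<and> monom_degree e = d}"
    using assms by (auto simp: homogeneous_of_degree_iff poly_ring_def)
  then show ?thesis
  proof (induction p rule: mpoly_induct)
    case (single e c)
    then have "(\<Sum>i<m. Poly_Mapping.lookup e i) = d"
      using monom_degree_superset[of "{..<m}" e] by simp
    then have "(\<Sum>i<m. Poly_Mapping.single e (of_nat (Poly_Mapping.lookup e i) * c)) =
        Poly_Mapping.single e (of_nat d * c)"
      by (auto intro!: poly_mapping_eqI simp: lookup_sum lookup_single when_def
          simp flip: sum_distrib_right of_nat_sum)
    then show ?case
      by (simp add: 1 pconst_def mult_single flip: single_of_nat)
  qed (simp_all add: pderivative_add algebra_simps sum.distrib)
qed

section \<open>Evaluation of polynomials in a commutative algebra\<close>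

definition monom_eval :: "(nat \<Rightarrow> 'a::comm_ring_1) \<Rightarrow> (nat \<Rightarrow>\<^sub>0 nat) \<Rightarrow> 'a" where
  "monom_eval y e = (\<Prod>i\<in>Poly_Mapping.keys e. y i ^ Poly_Mapping.lookup e i)"

lemma monom_eval_superset:
  assumes "finite A" "Poly_Mapping.keys e \<subseteq> A"
  shows "monom_eval y e = (\<Prod>i\<in>A. y i ^ Poly_Mapping.lookup e i)"
  unfolding monom_eval_def
  by (rule prod.mono_neutral_left) (use assms in \<open>auto simp: in_keys_iff\<close>)

lemma monom_eval_zero [simp]: "monom_eval y 0 = 1"
  by (simp add: monom_eval_def)

lemma monom_eval_single [simp]: "monom_eval y (Poly_Mapping.single i k) = y i ^ k"
  by (simp add: monom_eval_def)

lemma monom_eval_add: "monom_eval y (e + e') = monom_eval y e * monom_eval y e'"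
proof -
  let ?A = "Poly_Mapping.keys e \<union> Poly_Mapping.keys e'"
  have *: "finite ?A" "Poly_Mapping.keys (e + e') \<subseteq> ?A"
    using Poly_Mapping.keys_add[of e e'] by auto
  show ?thesis
    using monom_eval_superset[OF *, of y] monom_eval_superset[OF *(1), of e y]
      monom_eval_superset[OF *(1), of e' y]
    by (simp add: lookup_add prod.distrib power_add)
qed

lemma pvar_power: "pvar i ^ k = (Poly_Mapping.single (Poly_Mapping.single i k) 1 :: 'k::field mpoly)"
  by (induction k) (simp_all add: pvar_def mult_single flip: single_add)

lemma monom_eval_pvar: "monom_eval pvar e = (Poly_Mapping.single e 1 :: 'k::field mpoly)"
proof -
  have "(\<Prod>i\<in>A. Poly_Mapping.single (g i) (1::'k)) = Poly_Mapping.single (\<Sum>i\<in>A. g i) 1"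
    for A and g :: "nat \<Rightarrow> nat \<Rightarrow>\<^sub>0 nat"
    by (induction A rule: infinite_finite_induct) (simp_all add: mult_single)
  then show ?thesis
    using poly_mapping_expand[of e] by (simp add: monom_eval_def pvar_power)
qed

context comm_algebra
begin

lemma scale_one_mult: "scale c 1 * x = scale c x"
  by (metis scale_mult mult_1)

lemma scale_mult_right: "x * scale c y = scale c (x * y)"
  by (metis scale_mult mult.commute)

lemma scale_of_nat_mult: "scale (of_nat k * c) x * d = scale c (of_nat k * x * d)"
proof (induction k)
  case (Suc k)
  then show ?case
    by (simp add: algebra_simps scale_left_distrib scale_right_distrib scale_mult_right)
qed simp

definition peval :: "(nat \<Rightarrow> 'a) \<Rightarrow> 'k mpoly \<Rightarrow> 'a" where
  "peval y p = (\<Sum>e\<in>Poly_Mapping.keys p. scale (Poly_Mapping.lookup p e) (monom_eval y e))"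

lemma peval_superset:
  assumes "finite A" "Poly_Mapping.keys p \<subseteq> A"
  shows "peval y p = (\<Sum>e\<in>A. scale (Poly_Mapping.lookup p e) (monom_eval y e))"
  unfolding peval_def
  by (rule sum.mono_neutral_left) (use assms in \<open>auto simp: in_keys_iff\<close>)

lemma peval_zero [simp]: "peval y 0 = 0"
  by (simp add: peval_def)

lemma peval_add: "peval y (p + q) = peval y p + peval y q"
proof -
  let ?A = "Poly_Mapping.keys p \<union> Poly_Mapping.keys q"
  have *: "finite ?A" "Poly_Mapping.keys (p + q) \<subseteq> ?A"
    using Poly_Mapping.keys_add[of p q] by auto
  show ?thesis
    using peval_superset[OF *, of y] peval_superset[OF *(1), of p y]
      peval_superset[OF *(1), of q y]
    by (simp add: lookup_add sum.distrib scale_left_distrib)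
qed

lemma peval_sum: "peval y (sum f A) = (\<Sum>a\<in>A. peval y (f a))"
  by (induction A rule: infinite_finite_induct) (simp_all add: peval_add)

lemma peval_single: "peval y (Poly_Mapping.single e c) = scale c (monom_eval y e)"
  by (simp add: peval_def)

lemma peval_pconst [simp]: "peval y (pconst c) = scale c 1"
  by (simp add: pconst_def peval_single)

lemma peval_one [simp]: "peval y 1 = 1"
  using peval_pconst[of y 1] by (simp add: pconst_def)

lemma peval_pvar [simp]: "peval y (pvar i) = y i"
  by (simp add: pvar_def peval_single)

lemma peval_diff: "peval y (p - q) = peval y p - peval y q"
  using peval_add[of y "p - q" q] by simp

lemma peval_uminus: "peval y (- p) = - peval y p"
  using peval_diff[of y 0 p] by simp

lemma peval_mult: "peval y (p * q) = peval y p * peval y q"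
proof -
  have *: "peval y (Poly_Mapping.single e c * q) = scale c (monom_eval y e) * peval y q" for e c
    by (rule mpoly_induct[of q UNIV])
      (auto simp: mult_single peval_single monom_eval_add peval_add algebra_simps scale_mult_right
        simp flip: scale_mult)
  show ?thesis
    by (rule mpoly_induct[of p UNIV]) (auto simp: * peval_single peval_add distrib_right)
qed

lemma peval_power: "peval y (p ^ k) = peval y p ^ k"
  by (induction k) (simp_all add: peval_mult)

text \<open>The hypotheses speak of \<open>poly_ring m\<close> only, since the map of a
  \<open>fraction_field_via\<close> is unspecified elsewhere. Both that map and its composite with a
  morphism thereby become evaluations at the images of the variables.\<close>

lemma ring_hom_eq_peval:
  assumes one: "h 1 = 1"
    and add: "\<And>p q. p \<in> poly_ring m \<Longrightarrow> q \<in> poly_ring m \<Longrightarrow> h (p + q) = h p + h q"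
    and mult: "\<And>p q. p \<in> poly_ring m \<Longrightarrow> q \<in> poly_ring m \<Longrightarrow> h (p * q) = h p * h q"
    and const: "\<And>c p. p \<in> poly_ring m \<Longrightarrow> h (pconst c * p) = scale c (h p)"
    and "f \<in> poly_ring m"
  shows "h f = peval (\<lambda>i. h (pvar i)) f"
proof -
  have zero: "h 0 = 0"
    using add[of 0 0] by simp
  have power: "h (p ^ k) = h p ^ k" if "p \<in> poly_ring m" for p k
    by (induction k) (simp_all add: one mult that poly_ring_power)
  have prod: "h (prod p A) = (\<Prod>i\<in>A. h (p i))" if "\<And>i. i \<in> A \<Longrightarrow> p i \<in> poly_ring m" for p and A :: "nat set"
    using that by (induction A rule: infinite_finite_induct) (simp_all add: one mult poly_ring_prod)
  have "Poly_Mapping.keys f \<subseteq> {e. Poly_Mapping.keys e \<subseteq> {..<m}}"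
    using assms(5) by (simp add: poly_ring_iff_keys)
  then show ?thesis
  proof (induction f rule: mpoly_induct)
    case (single e c)
    then have e: "i < m" if "i \<in> Poly_Mapping.keys e" for i
      using that by auto
    have "h (monom_eval pvar e) = monom_eval (\<lambda>i. h (pvar i)) e"
      by (simp add: monom_eval_def prod poly_ring_power power e)
    moreover have "Poly_Mapping.single e c = pconst c * monom_eval pvar e"
      by (simp add: monom_eval_pvar pconst_def mult_single)
    moreover have "monom_eval pvar e \<in> poly_ring m"
      using single by (simp add: monom_eval_pvar poly_ring_single)
    ultimately show ?case
      by (metis const peval_single)
  next
    case (add p q)
    then show ?case
      by (simp add: peval_add assms(2) poly_ring_iff_keys)
  qed (simp add: zero)
qed

section \<open>Derivations and the chain rule\<close>

definition derivation :: "('a \<Rightarrow> 'a) \<Rightarrow> bool" where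
  "derivation D \<longleftrightarrow> (\<forall>x y. D (x + y) = D x + D y) \<and>
     (\<forall>c x. D (scale c x) = scale c (D x)) \<and> (\<forall>x y. D (x * y) = x * D y + D x * y)"

lemma derivation_add: "derivation D \<Longrightarrow> D (x + y) = D x + D y"
  and derivation_scale: "derivation D \<Longrightarrow> D (scale c x) = scale c (D x)"
  and derivation_mult: "derivation D \<Longrightarrow> D (x * y) = x * D y + D x * y"
  by (auto simp: derivation_def)

lemma derivation_zero: "derivation D \<Longrightarrow> D 0 = 0"
  using derivation_add[of D 0 0] by simp

lemma derivation_one: "derivation D \<Longrightarrow> D 1 = 0"
  using derivation_mult[of D 1 1] by simp

lemma derivation_power: "derivation D \<Longrightarrow> D (x ^ k) = of_nat k * x ^ (k - 1) * D x"
proof (induction k)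
  case (Suc k)
  then show ?case
    by (cases k) (simp_all add: derivation_mult algebra_simps)
qed (simp add: derivation_one)

lemma derivation_prod:
  assumes "derivation D" "finite A"
  shows "D (prod f A) = (\<Sum>i\<in>A. prod f (A - {i}) * D (f i))"
  using assms(2)
proof (induction A rule: finite_induct)
  case (insert a A)
  have "(\<Sum>i\<in>A. prod f (insert a A - {i}) * D (f i)) = (\<Sum>i\<in>A. f a * (prod f (A - {i}) * D (f i)))"
  proof (rule sum.cong[OF refl])
    fix i assume "i \<in> A"
    then have "insert a A - {i} = insert a (A - {i})"
      using insert by auto
    then show "prod f (insert a A - {i}) * D (f i) = f a * (prod f (A - {i}) * D (f i))"
      using insert by (simp add: mult.assoc)
  qed
  then show ?case
    using insert by (simp add: derivation_mult[OF assms(1)] sum_distrib_left algebra_simps)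
qed (simp add: derivation_one assms(1))

text \<open>The chain rule: on polynomial expressions a derivation is determined by its values at
  the \<open>y i\<close>. By linearity only monomials need a computation.\<close>

lemma derivation_peval:
  assumes D: "derivation D" and "p \<in> poly_ring m"
  shows "D (peval y p) = (\<Sum>i<m. peval y (pderivative i p) * D (y i))"
proof -
  have "Poly_Mapping.keys p \<subseteq> {e. Poly_Mapping.keys e \<subseteq> {..<m}}"
    using assms by (simp add: poly_ring_iff_keys)
  then show ?thesis
  proof (induction p rule: mpoly_induct)
    case (single e c)
    \<comment> \<open>If the exponent at \<open>i\<close> is 0, both truncated subtractions leave
      their arguments unchanged, so the identity needs no case distinction.\<close>
    have *: "prod (\<lambda>j. y j ^ Poly_Mapping.lookup e j) ({..<m} - {i}) * y i ^ (Poly_Mapping.lookup e i - 1) =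
        monom_eval y (e - Poly_Mapping.single i 1)" if "i < m" for i
    proof -
      have "Poly_Mapping.keys (e - Poly_Mapping.single i 1) \<subseteq> {..<m}"
        using single by (auto simp: in_keys_iff lookup_minus subset_iff)
      then have "monom_eval y (e - Poly_Mapping.single i 1) =
          (\<Prod>j<m. y j ^ Poly_Mapping.lookup (e - Poly_Mapping.single i 1) j)"
        by (simp add: monom_eval_superset)
      also have "\<dots> = y i ^ (Poly_Mapping.lookup e i - 1) *
          (\<Prod>j\<in>{..<m} - {i}. y j ^ Poly_Mapping.lookup (e - Poly_Mapping.single i 1) j)"
        using that by (subst prod.remove[of _ i]) (auto simp: lookup_minus)
      also have "(\<Prod>j\<in>{..<m} - {i}. y j ^ Poly_Mapping.lookup (e - Poly_Mapping.single i 1) j) =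
          (\<Prod>j\<in>{..<m} - {i}. y j ^ Poly_Mapping.lookup e j)"
        by (rule prod.cong) (auto simp: lookup_minus lookup_single when_def)
      finally show ?thesis by (simp add: mult.commute)
    qed
    have "D (monom_eval y e) = (\<Sum>i<m. prod (\<lambda>j. y j ^ Poly_Mapping.lookup e j) ({..<m} - {i}) *
        (of_nat (Poly_Mapping.lookup e i) * y i ^ (Poly_Mapping.lookup e i - 1) * D (y i)))"
      using single monom_eval_superset[of "{..<m}" e y]
      by (simp add: derivation_prod[OF D] derivation_power[OF D])
    also have "\<dots> = (\<Sum>i<m. of_nat (Poly_Mapping.lookup e i) * (prod (\<lambda>j. y j ^ Poly_Mapping.lookup e j) ({..<m} - {i}) *
        y i ^ (Poly_Mapping.lookup e i - 1)) * D (y i))"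
      by (simp add: mult_ac)
    also have "\<dots> = (\<Sum>i<m. of_nat (Poly_Mapping.lookup e i) * monom_eval y (e - Poly_Mapping.single i 1) * D (y i))"
      by (rule sum.cong) (simp_all only: * lessThan_iff)
    finally show ?case
      by (simp only: peval_single derivation_scale[OF D] pderivative_single scale_sum_right scale_of_nat_mult)
  qed (simp_all add: peval_add derivation_add[OF D] derivation_zero[OF D] pderivative_add algebra_simps sum.distrib)
qed

end

section \<open>Gelfand-Kirillov dimension\<close>

context comm_algebra
begin

text \<open>Since \<open>dim\<close> is the cardinality of a basis, that basis must be known to be
  finite before the exchange bound applies. Finiteness of \<open>X\<close> bounds every independent
  subset of its span.\<close>

lemma card_le_dim_span:
  assumes "finite X" "B \<subseteq> span X" "\<not> dependent B"
  shows "card B \<le> dim (span X)"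
proof -
  obtain C where C: "C \<subseteq> span X" "\<not> dependent C" "span X \<subseteq> span C" "card C = dim (span X)"
    using basis_exists by blast
  have "finite C"
    using independent_span_bound[OF assms(1) C(2) C(1)] by simp
  then show ?thesis
    using independent_span_bound[of C B] assms C by auto
qed

text \<open>Monomials in \<open>w\<close> with all exponents at most \<open>m div N\<close> are
  linearly independent and have degree at most \<open>m\<close>. This bounds the growth from below
  by (m/N)^N, and the resulting bound for the quotient of logarithms tends to
  \<open>N\<close>.\<close>

lemma GKdim_ge_of_algebraically_independent:
  assumes N: "N > 0" and w: "\<And>H. H \<in> poly_ring N \<Longrightarrow> H \<noteq> 0 \<Longrightarrow> peval w H \<noteq> 0"
  shows "ereal (real N) \<le> GKdim"
proof -
  define S where "S = w ` {..<N}"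
  define expo :: "(nat \<Rightarrow> nat) \<Rightarrow> nat \<Rightarrow>\<^sub>0 nat"
    where "expo f = (\<Sum>i<N. Poly_Mapping.single i (f i))" for f
  have lookup_expo: "Poly_Mapping.lookup (expo f) i = (if i < N then f i else 0)" for f i
    by (auto simp: expo_def lookup_sum lookup_single when_def)
  have keys_expo: "Poly_Mapping.keys (expo f) \<subseteq> {..<N}" for f
    by (auto simp: in_keys_iff lookup_expo split: if_splits)
  have ring_expo: "Poly_Mapping.single (expo f) c \<in> poly_ring N" for f c
    by (rule poly_ring_single[OF keys_expo])
  have dim_ge: "(m div N + 1) ^ N \<le> dim (growth_space S m)" for m
  proof -
    \<comment> \<open>A box of exponents, instead of all exponents of total degree at most
      \<open>m\<close>, has an exact power as its cardinality. Extensionality of the functions makes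
      \<open>expo\<close> injective on it.\<close>
    define F where "F = {..<N} \<rightarrow>\<^sub>E {..m div N}"
    define X where "X = {prod_list xs | xs. set xs \<subseteq> S \<and> length xs \<le> m}"
    let ?mon = "\<lambda>f. monom_eval w (expo f)"
    have fin: "finite F"
      by (simp add: F_def finite_PiE)
    have inj_expo: "inj_on expo F"
    proof (rule inj_onI)
      fix f g assume fg: "f \<in> F" "g \<in> F" "expo f = expo g"
      show "f = g"
      proof (rule PiE_ext)
        show "f \<in> {..<N} \<rightarrow>\<^sub>E {..m div N}" "g \<in> {..<N} \<rightarrow>\<^sub>E {..m div N}"
          using fg by (auto simp: F_def)
        show "f i = g i" if "i \<in> {..<N}" for i
          using arg_cong[OF fg(3), of "\<lambda>e. Poly_Mapping.lookup e i"] that by (simp add: lookup_expo)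
      qed
    qed
    have inj: "inj_on ?mon F"
    proof (rule inj_onI, rule ccontr)
      fix f g assume fg: "f \<in> F" "g \<in> F" "?mon f = ?mon g" "f \<noteq> g"
      let ?H = "Poly_Mapping.single (expo f) 1 - Poly_Mapping.single (expo g) (1::'k)"
      have "expo f \<noteq> expo g"
        using fg inj_expo by (auto dest: inj_onD)
      then have "Poly_Mapping.lookup ?H (expo f) \<noteq> 0"
        by (simp add: lookup_minus lookup_single when_def)
      then have "?H \<noteq> 0"
        by auto
      then have "peval w ?H \<noteq> 0"
        by (intro w poly_ring_diff ring_expo)
      then show False
        using fg(3) by (simp add: peval_diff peval_single)
    qed
    have "\<not> dependent (?mon ` F)"
    proof
      assume "dependent (?mon ` F)"
      then obtain u where u: "\<exists>v\<in>?mon ` F. u v \<noteq> 0" "(\<Sum>v\<in>?mon ` F. scale (u v) v) = 0"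
        using fin by (auto simp: dependent_finite)
      define H where "H = (\<Sum>f\<in>F. Poly_Mapping.single (expo f) (u (?mon f)))"
      have "peval w H = 0"
        using u(2) by (simp add: H_def peval_sum peval_single sum.reindex[OF inj])
      then have "H = 0"
        using w[of H] by (auto simp: H_def intro!: poly_ring_sum ring_expo)
      have "u (?mon f) = 0" if "f \<in> F" for f
      proof -
        have "Poly_Mapping.lookup H (expo f) = (\<Sum>g\<in>F. if g = f then u (?mon f) else 0)"
          unfolding H_def lookup_sum
          by (rule sum.cong)
            (use that inj_expo in \<open>auto simp: lookup_single when_def dest: inj_onD\<close>)
        also have "\<dots> = u (?mon f)"
          using fin that by simp
        finally show ?thesis
          using \<open>H = 0\<close> by simp
      qed
      then show False
        using u(1) by auto
    qed
    moreover have "?mon ` F \<subseteq> X"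
    proof clarify
      fix f assume f: "f \<in> F"
      have "\<exists>xs. set xs \<subseteq> S \<and> length xs = (\<Sum>i\<in>A. f i) \<and> prod_list xs = (\<Prod>i\<in>A. w i ^ f i)"
        if "finite A" "A \<subseteq> {..<N}" for A
        using that
      proof (induction A rule: finite_induct)
        case (insert a A)
        then obtain xs where "set xs \<subseteq> S" "length xs = (\<Sum>i\<in>A. f i)" "prod_list xs = (\<Prod>i\<in>A. w i ^ f i)"
          by auto
        then show ?case
          using insert by (intro exI[of _ "replicate (f a) (w a) @ xs"]) (auto simp: S_def prod_list_replicate)
      qed simp
      then obtain xs where xs: "set xs \<subseteq> S" "length xs = (\<Sum>i<N. f i)" "prod_list xs = (\<Prod>i<N. w i ^ f i)"
        by blast
      have "(\<Sum>i<N. f i) \<le> (\<Sum>i<N. m div N)"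
        using f by (intro sum_mono) (auto simp: F_def PiE_def Pi_def)
      then have "length xs \<le> m"
        using xs(2) le_trans[OF _ times_div_less_eq_dividend[of N m]] by simp
      moreover have "?mon f = (\<Prod>i<N. w i ^ f i)"
        using keys_expo by (simp add: monom_eval_superset[of "{..<N}"] lookup_expo)
      ultimately show "?mon f \<in> X"
        using xs by (auto simp: X_def intro!: exI[of _ xs])
    qed
    moreover have "finite X"
    proof -
      have "X = prod_list ` {xs. set xs \<subseteq> S \<and> length xs \<le> m}"
        by (auto simp: X_def)
      then show ?thesis
        by (simp add: S_def finite_lists_length_le)
    qed
    ultimately have "card (?mon ` F) \<le> dim (span X)"
      by (intro card_le_dim_span) (auto intro: span_base)
    moreover have "card (?mon ` F) = (m div N + 1) ^ N"
      unfolding card_image[OF inj] by (simp add: F_def card_PiE)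
    ultimately show ?thesis
      by (simp add: growth_space_def X_def)
  qed
  have ev: "\<forall>\<^sub>F m in sequentially. ereal (real N * (ln (real m) - ln (real N)) / ln (real m)) \<le>
      ereal (ln (real (dim (growth_space S m))) / ln (real m))"
  proof (rule eventually_mono[OF eventually_ge_at_top[of 2]])
    \<comment> \<open>From 2 on, \<open>ln (real m)\<close> is positive, so dividing by it preserves
      the inequality.\<close>
    fix m :: nat assume m: "2 \<le> m"
    have "real m / real N \<le> real (m div N + 1)"
    proof -
      have "m \<le> (m div N + 1) * N"
        using dividend_less_div_times[OF N, of m] by simp
      then have "real m \<le> real (m div N + 1) * real N"
        by (metis of_nat_le_iff of_nat_mult)
      then show ?thesis
        using N by (simp add: pos_divide_le_eq)
    qed
    then have "(real m / real N) ^ N \<le> real (m div N + 1) ^ N"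
      by (intro power_mono) auto
    also have "\<dots> \<le> real (dim (growth_space S m))"
      using dim_ge[of m] by (metis of_nat_le_iff of_nat_power)
    finally have "ln ((real m / real N) ^ N) \<le> ln (real (dim (growth_space S m)))"
      using m N by (intro ln_mono) auto
    then have "real N * (ln (real m) - ln (real N)) \<le> ln (real (dim (growth_space S m)))"
      using m N by (simp add: ln_realpow ln_div)
    then show "ereal (real N * (ln (real m) - ln (real N)) / ln (real m)) \<le>
        ereal (ln (real (dim (growth_space S m))) / ln (real m))"
      using m by (simp add: divide_right_mono)
  qed
  have "(\<lambda>m. real N * (ln (real m) - ln (real N)) / ln (real m)) \<longlonglongrightarrow> real N"
    by real_asymp
  then have "limsup (\<lambda>m. ereal (real N * (ln (real m) - ln (real N)) / ln (real m))) = ereal (real N)"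
    by (intro lim_imp_Limsup) (auto intro: tendsto_intros)
  then have "ereal (real N) \<le> limsup (\<lambda>m. ereal (ln (real (dim (growth_space S m))) / ln (real m)))"
    using Limsup_mono[OF ev] by simp
  also have "\<dots> \<le> GKdim"
    unfolding GKdim_def by (rule SUP_upper) (simp add: S_def)
  finally show ?thesis .
qed

end

section \<open>Integer-valued valuations on a field\<close>

locale int_valuation = comm_algebra scale
  for scale :: "'k::field \<Rightarrow> 'a::field \<Rightarrow> 'a" +
  fixes v :: "'a \<Rightarrow> int"
  assumes v_mult: "x \<noteq> 0 \<Longrightarrow> y \<noteq> 0 \<Longrightarrow> v (x * y) = v x + v y"
    and v_add: "x \<noteq> 0 \<Longrightarrow> y \<noteq> 0 \<Longrightarrow> x + y \<noteq> 0 \<Longrightarrow> min (v x) (v y) \<le> v (x + y)"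
    and v_scalar: "c \<noteq> 0 \<Longrightarrow> v (scale c 1) = 0"
begin

text \<open>The integer \<open>v 0\<close> carries no meaning. This predicate is the inequality v(x)
  \<ge> c with the value of 0 read as infinity, so that sums and products can be estimated without
  excluding 0.\<close>

definition vge :: "'a \<Rightarrow> int \<Rightarrow> bool" where
  "vge x c \<longleftrightarrow> x = 0 \<or> c \<le> v x"

lemma vge_zero [simp]: "vge 0 c"
  by (simp add: vge_def)

lemma vge_self: "vge x (v x)"
  by (simp add: vge_def)

lemma vge_mono: "vge x c \<Longrightarrow> d \<le> c \<Longrightarrow> vge x d"
  by (auto simp: vge_def)

lemma vge_add: "vge x c \<Longrightarrow> vge y c \<Longrightarrow> vge (x + y) c"
  using v_add[of x y] by (cases "x = 0"; cases "y = 0"; cases "x + y = 0") (auto simp: vge_def)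

lemma vge_sum: "(\<And>i. i \<in> A \<Longrightarrow> vge (f i) c) \<Longrightarrow> vge (sum f A) c"
  by (induction A rule: infinite_finite_induct) (auto intro: vge_add)

lemma vge_mult: "vge x c \<Longrightarrow> vge y d \<Longrightarrow> vge (x * y) (c + d)"
  by (cases "x = 0"; cases "y = 0") (auto simp: vge_def v_mult)

lemma v_one [simp]: "v 1 = 0"
  using v_scalar[of 1] by simp

lemma vge_scale: "vge x c \<Longrightarrow> vge (scale a x) c"
  using vge_mult[of "scale a 1" 0 x c] v_scalar[of a]
  by (cases "a = 0") (auto simp: scale_one_mult vge_def)

lemma vge_uminus: "vge x c \<Longrightarrow> vge (- x) c"
  using vge_scale[of x c "- 1"] by simp

lemma vge_diff: "vge x c \<Longrightarrow> vge y c \<Longrightarrow> vge (x - y) c"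
  using vge_add[of x c "- y"] vge_uminus[of y c] by simp

lemma v_power: "x \<noteq> 0 \<Longrightarrow> v (x ^ k) = int k * v x"
  by (induction k) (simp_all add: v_mult algebra_simps)

lemma v_inverse: "x \<noteq> 0 \<Longrightarrow> v (inverse x) = - v x"
  using v_mult[of x "inverse x"] by simp

lemma vge_power: "vge x c \<Longrightarrow> vge (x ^ k) (int k * c)"
  by (induction k) (auto simp: algebra_simps intro: vge_mult vge_self simp: vge_def[of 1])

lemma vge_monom_eval:
  assumes "\<And>i. i \<in> Poly_Mapping.keys e \<Longrightarrow> vge (y i) c"
  shows "vge (monom_eval y e) (int (monom_degree e) * c)"
proof -
  have "vge (\<Prod>i\<in>A. y i ^ Poly_Mapping.lookup e i) (int (\<Sum>i\<in>A. Poly_Mapping.lookup e i) * c)"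
    if "finite A" "A \<subseteq> Poly_Mapping.keys e" for A
    using that
  proof (induction A rule: finite_induct)
    case (insert a A)
    then have "vge (y a ^ Poly_Mapping.lookup e a * (\<Prod>i\<in>A. y i ^ Poly_Mapping.lookup e i))
       (int (Poly_Mapping.lookup e a) * c + int (\<Sum>i\<in>A. Poly_Mapping.lookup e i) * c)"
      by (intro vge_mult vge_power assms) auto
    then show ?case
      using insert by (simp add: algebra_simps)
  qed (simp add: vge_def)
  then show ?thesis
    by (simp add: monom_eval_def monom_degree_def)
qed

text \<open>The bound is required for each monomial because \<open>c\<close> may have either sign:
  for negative \<open>c\<close> the highest degree is the worst case, for positive \<open>c\<close>
  the lowest.\<close>

lemma vge_peval:
  assumes "\<And>i. i < m \<Longrightarrow> vge (y i) c" "p \<in> poly_ring m"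
    and "\<And>e. e \<in> Poly_Mapping.keys p \<Longrightarrow> d \<le> int (monom_degree e) * c"
  shows "vge (peval y p) d"
  unfolding peval_def
proof (intro vge_sum vge_scale)
  fix e assume e: "e \<in> Poly_Mapping.keys p"
  then have "vge (monom_eval y e) (int (monom_degree e) * c)"
    using assms(1,2) by (intro vge_monom_eval) (auto simp: poly_ring_def)
  then show "vge (monom_eval y e) d"
    using assms(3)[OF e] by (rule vge_mono)
qed

text \<open>The term of least value is unique. If the sum vanished, that term would be minus a sum
  of terms of strictly larger value.\<close>

lemma sum_distinct_valuations_nonzero:
  assumes "finite J" "J \<noteq> {}" "\<And>j. j \<in> J \<Longrightarrow> f j \<noteq> 0" "inj_on (\<lambda>j. v (f j)) J"
  shows "sum f J \<noteq> 0"
proof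
  assume 0: "sum f J = 0"
  obtain j where j: "j \<in> J" "\<And>i. i \<in> J \<Longrightarrow> v (f j) \<le> v (f i)"
    using arg_min_if_finite(1,2)[OF assms(1,2), of "\<lambda>j. v (f j)"] by (metis leI)
  have "vge (\<Sum>i\<in>J - {j}. f i) (v (f j) + 1)"
  proof (rule vge_sum)
    fix i assume i: "i \<in> J - {j}"
    then have "v (f i) \<noteq> v (f j)"
      using assms(4) j by (auto dest: inj_onD)
    then show "vge (f i) (v (f j) + 1)"
      using j(2)[of i] i by (auto simp: vge_def)
  qed
  moreover have "f j = - (\<Sum>i\<in>J - {j}. f i)"
    using 0 sum.remove[OF assms(1) j(1), of f] by (simp add: eq_neg_iff_add_eq_0)
  ultimately show False
    using vge_uminus assms(3)[OF j(1)] by (fastforce simp: vge_def)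
qed

end

section \<open>Fields with a valuation compatible with the bracket\<close>

text \<open>The increasing enumeration of the indices other than \<open>b\<close>, which is also how
  \<open>mat_delete\<close> renumbers columns.\<close>

definition skip :: "nat \<Rightarrow> nat \<Rightarrow> nat" where
  "skip b i = (if i < b then i else Suc i)"

lemma skip_neq: "skip b i \<noteq> b"
  by (simp add: skip_def)

lemma skip_less: "i < n \<Longrightarrow> skip b i < Suc n"
  by (simp add: skip_def)

lemma skip_eq_iff [simp]: "skip b i = skip b j \<longleftrightarrow> i = j"
  by (auto simp: skip_def)

lemma skip_surj: "a < Suc n \<Longrightarrow> b < Suc n \<Longrightarrow> a \<noteq> b \<Longrightarrow> \<exists>s<n. skip b s = a"
  by (intro exI[of _ "if a < b then a else a - 1"]) (auto simp: skip_def)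

text \<open>Expansion along the last row, the gradient of \<Omega>. Deleting column \<open>b\<close>
  leaves the identity matrix; deleting another column \<open>j\<close> removes the only nonzero
  entry of the row of \<open>pvar j\<close>. The sign stays open, as valuations do not see
  it.\<close>

lemma jacobian_bracket_skip:
  assumes b: "b \<le> n"
  shows "jacobian_bracket n \<Omega> (map (\<lambda>i. pvar (skip b i)) [0..<n]) \<in> {pderivative b \<Omega>, - pderivative b \<Omega>}"
proof -
  let ?fs = "map (\<lambda>i. pvar (skip b i)) [0..<n]"
  define A where "A = mat (n + 1) (n + 1) (\<lambda>(i, j). pderivative j ((?fs @ [\<Omega>]) ! i))"
  have A: "A \<in> carrier_mat (n + 1) (n + 1)"
    by (simp add: A_def)
  have A_last: "A $$ (n, j) = pderivative j \<Omega>" if "j \<le> n" for j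
    using that by (simp add: A_def nth_append)
  have A_row: "A $$ (i, j) = (if j = skip b i then 1 else 0)" if "i < n" "j \<le> n" for i j
    using that by (auto simp: A_def nth_append pderivative_pvar)
  have delete: "mat_delete A n j = mat n n (\<lambda>(i, k). if skip j k = skip b i then 1 else 0)"
    if "j \<le> n" for j
  proof (rule eq_matI)
    fix i k
    assume "i < dim_row (mat n n (\<lambda>(i, k). if skip j k = skip b i then 1 else (0 :: 'a mpoly)))"
      and "k < dim_col (mat n n (\<lambda>(i, k). if skip j k = skip b i then 1 else (0 :: 'a mpoly)))"
    then have ik: "i < n" "k < n"
      by auto
    then have "mat_delete A n j $$ (i, k) = A $$ (i, skip j k)"
      using A by (simp add: mat_delete_def skip_def)
    also have "\<dots> = (if skip j k = skip b i then 1 else 0)"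
      using ik skip_less[OF ik(2), of j] by (simp add: A_row)
    finally show "mat_delete A n j $$ (i, k) = mat n n (\<lambda>(i, k). if skip j k = skip b i then 1 else 0) $$ (i, k)"
      using ik by simp
  qed (use A in auto)
  have cof_b: "cofactor A n b = (-1) ^ (n + b)"
  proof -
    have "mat_delete A n b = 1\<^sub>m n"
      unfolding delete[OF b] by (rule eq_matI) auto
    then show ?thesis
      by (simp add: cofactor_def)
  qed
  have cof: "cofactor A n j = 0" if j: "j \<le> n" "j \<noteq> b" for j
  proof -
    obtain s where s: "s < n" "skip b s = j"
      using skip_surj[of j n b] j b by auto
    have "det (mat_delete A n j) = (\<Sum>k<n. mat_delete A n j $$ (s, k) * cofactor (mat_delete A n j) s k)"
      using A s by (intro laplace_expansion_row) (auto simp: mat_delete_carrier[where m = "n + 1" and n = "n + 1", simplified])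
    also have "\<dots> = 0"
      by (rule sum.neutral) (use s j in \<open>auto simp: delete skip_neq\<close>)
    finally show ?thesis
      by (simp add: cofactor_def)
  qed
  have "det A = (\<Sum>j<n + 1. A $$ (n, j) * cofactor A n j)"
    using A by (intro laplace_expansion_row) auto
  also have "\<dots> = (\<Sum>j<n + 1. if j = b then pderivative b \<Omega> * (-1) ^ (n + b) else 0)"
    by (rule sum.cong) (auto simp: A_last cof cof_b)
  also have "\<dots> = pderivative b \<Omega> * (-1) ^ (n + b)"
    using b by simp
  finally show ?thesis
    unfolding jacobian_bracket_def A_def[symmetric] by (cases "even (n + b)") auto
qed

text \<open>In degrees beyond those of the finite spanning set, the quotient by the gradient ideal
  vanishes. Taking the part of degree \<open>M\<close> of an identity in the quotient makes the
  coefficients homogeneous.\<close>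

lemma potential_pvar_power:
  assumes "is_potential m \<Omega>" "homogeneous_of_degree (Suc D) \<Omega>" "i < m"
  obtains M h where "M \<ge> D" "pvar i ^ M = (\<Sum>j<m. h j * pderivative j \<Omega>)"
    and "\<And>j. j < m \<Longrightarrow> h j \<in> poly_ring m"
    and "\<And>j e. j < m \<Longrightarrow> e \<in> Poly_Mapping.keys (h j) \<Longrightarrow> monom_degree e = M - D"
proof -
  obtain B where B: "finite B" "\<And>f. f \<in> poly_ring m \<Longrightarrow>
      \<exists>c. f - (\<Sum>b\<in>B. pconst (c b) * b) \<in> gradient_ideal m \<Omega>"
    using assms(1) unfolding is_potential_def by blast
  \<comment> \<open>\<open>insert 0\<close> provides a maximum when no exponent occurs in
    \<open>B\<close>.\<close>
  define N where "N = Max (insert 0 (monom_degree ` (\<Union>b\<in>B. Poly_Mapping.keys b)))"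
  have N: "monom_degree e \<le> N" if "b \<in> B" "e \<in> Poly_Mapping.keys b" for b e
    unfolding N_def using B(1) that by (intro Max_ge) auto
  \<comment> \<open>This exceeds all degrees in \<open>B\<close>, and subtracting the degree
    \<open>D\<close> of a partial derivative leaves \<open>N + 1\<close> for the
    coefficients.\<close>
  define M where "M = N + 1 + D"
  have "pvar i ^ M \<in> poly_ring m"
    using assms(3) by (intro poly_ring_power) simp
  then obtain c h where h: "\<And>j. j < m \<Longrightarrow> h j \<in> poly_ring m"
    and eq: "pvar i ^ M - (\<Sum>b\<in>B. pconst (c b) * b) = (\<Sum>j<m. h j * pderivative j \<Omega>)"
    using B(2) unfolding gradient_ideal_def by blast
  have low: "hpart M (pconst (c b) * b) = 0" if "b \<in> B" for b
  proof -
    have "Poly_Mapping.keys (pconst (c b) * b) \<subseteq> Poly_Mapping.keys b"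
      using keys_mult[of "pconst (c b)" b] by (auto simp: pconst_def split: if_splits)
    then have "Poly_Mapping.keys (hpart M (pconst (c b) * b)) = {}"
      using N[OF that] by (fastforce simp: keys_mpart M_def)
    then show ?thesis by simp
  qed
  have "hpart M (pvar i ^ M) - (\<Sum>b\<in>B. hpart M (pconst (c b) * b)) =
      (\<Sum>j<m. hpart M (h j * pderivative j \<Omega>))"
    using arg_cong[OF eq, of "hpart M"] by (simp only: mpart_diff mpart_sum)
  then have "pvar i ^ M = (\<Sum>j<m. hpart M (h j * pderivative j \<Omega>))"
    by (simp add: low pvar_power mpart_single del: sum.lessThan_Suc)
  also have "\<dots> = (\<Sum>j<m. hpart (N + 1) (h j) * pderivative j \<Omega>)"
    unfolding M_def by (intro sum.cong hpart_mult homogeneous_pderivative[OF assms(2)]) simp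
  finally show ?thesis
    using h M_def by (intro that[of M "\<lambda>j. hpart (N + 1) (h j)"]) (auto simp: poly_ring_mpart keys_mpart)
qed

context nambu_poisson_algebra
begin

text \<open>The entry at \<open>s\<close> is overwritten, so \<open>us\<close> only supplies the
  other arguments. Facts about derivations thus apply to the bracket one slot at a time.\<close>

lemma derivation_br: "length us = n \<Longrightarrow> s < n \<Longrightarrow> derivation (\<lambda>z. br (us[s := z]))"
  by (simp add: derivation_def br_add br_scale br_Leibniz)

lemma br_eq_0: "length us = n \<Longrightarrow> s < n \<Longrightarrow> us ! s = 0 \<Longrightarrow> br us = 0"
  using derivation_zero[OF derivation_br, of us s] by (metis list_update_id)

lemma br_repeated: "length us = n \<Longrightarrow> s < n \<Longrightarrow> j < n \<Longrightarrow> j \<noteq> s \<Longrightarrow> br (us[s := us ! j]) = 0"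
  by (rule br_alternating[of _ s j]) auto

end

locale nambu_valuation =
  int_valuation scale v + nambu_poisson_algebra scale n br
  for scale :: "'k::field_char_0 \<Rightarrow> 'a::field \<Rightarrow> 'a" and v n br +
  assumes v_br: "length us = n \<Longrightarrow> (\<And>s. s < n \<Longrightarrow> us ! s \<noteq> 0) \<Longrightarrow> vge (br us) (\<Sum>s<n. v (us ! s))"
begin

text \<open>A zero argument, to which \<open>v_br\<close> does not apply, makes the bracket zero;
  hence slotwise lower bounds suffice.\<close>

lemma vge_br:
  assumes "length us = n" "\<And>s. s < n \<Longrightarrow> vge (us ! s) (c s)"
  shows "vge (br us) (sum c {..<n})"
proof (cases "\<forall>s<n. us ! s \<noteq> 0")
  case True
  then have "vge (br us) (\<Sum>s<n. v (us ! s))"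
    using assms(1) by (intro v_br) auto
  moreover have "sum c {..<n} \<le> (\<Sum>s<n. v (us ! s))"
    using assms(2) True by (intro sum_mono) (auto simp: vge_def)
  ultimately show ?thesis by (rule vge_mono)
next
  case False
  then show ?thesis
    using br_eq_0[OF assms(1)] by auto
qed

text \<open>What a morphism leaves in the target field: the images \<open>y i\<close> of the
  variables, the relation \<Omega>(y) = \<xi>, and the brackets omitting one coordinate, known up to
  sign.\<close>

context
  fixes \<Omega> :: "'k mpoly" and d\<^sub>0 :: nat and \<xi> :: 'k and y :: "nat \<Rightarrow> 'a"
  assumes pot: "is_potential (n + 1) \<Omega>" and hom: "homogeneous_of_degree (n + 1 + d\<^sub>0) \<Omega>"
    and d\<^sub>0: "d\<^sub>0 > 0" and \<xi>: "\<xi> \<noteq> 0" and y_\<Omega>: "peval y \<Omega> = scale \<xi> 1"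
    and br_y: "\<And>b. b \<le> n \<Longrightarrow> br (map (\<lambda>i. y (skip b i)) [0..<n]) \<in>
      {peval y (pderivative b \<Omega>), - peval y (pderivative b \<Omega>)}"
begin

lemma \<Omega>_ring: "\<Omega> \<in> poly_ring (n + 1)"
  using pot by (simp add: is_potential_def)

text \<open>The bracket yields \<open>n * a\<close>, whereas evaluating a form of degree
  \<open>n + d\<^sub>0\<close> would give only \<open>(n + d\<^sub>0) * a\<close>, which is smaller
  when \<open>a\<close> is negative.\<close>

lemma vge_gradient:
  assumes "\<And>i. i < n + 1 \<Longrightarrow> vge (y i) a" "b < n + 1"
  shows "vge (peval y (pderivative b \<Omega>)) (int n * a)"
proof -
  have "vge (br (map (\<lambda>i. y (skip b i)) [0..<n])) (\<Sum>s<n. a)"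
    using assms skip_less[of _ n b] by (intro vge_br) auto
  then show ?thesis
    using br_y[of b] assms(2) vge_uminus[of "- peval y (pderivative b \<Omega>)"] by auto
qed

text \<open>For a negative minimum \<open>a\<close>, the power \<open>y k ^ M\<close> has value
  \<open>M * a\<close>, yet it is a combination of terms of value at least
  \<open>(M - n - d\<^sub>0) * a + n * a\<close>, which is larger by
  \<open>- d\<^sub>0 * a\<close>.\<close>

lemma coordinates_nonnegative:
  assumes "i < n + 1"
  shows "vge (y i) 0"
proof (rule ccontr)
  assume i: "\<not> vge (y i) 0"
  \<comment> \<open>The minimum is taken over the nonzero coordinates, where \<open>v\<close> is
    meaningful.\<close>
  define Z where "Z = {j. j < n + 1 \<and> y j \<noteq> 0}"
  have Z: "finite Z" "i \<in> Z"
    using i assms by (auto simp: Z_def vge_def)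
  then obtain k where k: "k \<in> Z" "\<And>j. j \<in> Z \<Longrightarrow> v (y k) \<le> v (y j)"
    using arg_min_if_finite(1,2)[of Z "\<lambda>j. v (y j)"] by (metis empty_iff leI)
  define a where "a = v (y k)"
  have a: "a < 0"
    using i k(2)[OF Z(2)] by (auto simp: a_def vge_def)
  have y_ge: "vge (y j) a" if "j < n + 1" for j
    using k(2)[of j] that by (auto simp: Z_def vge_def a_def)
  have k_less: "k < n + 1" and k_nz: "y k \<noteq> 0"
    using k(1) by (auto simp: Z_def)
  have hom': "homogeneous_of_degree (Suc (n + d\<^sub>0)) \<Omega>"
    using hom by simp
  obtain M h where M: "M \<ge> n + d\<^sub>0" "pvar k ^ M = (\<Sum>j<n + 1. h j * pderivative j \<Omega>)"
    and h: "\<And>j. j < n + 1 \<Longrightarrow> h j \<in> poly_ring (n + 1)"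
      "\<And>j e. j < n + 1 \<Longrightarrow> e \<in> Poly_Mapping.keys (h j) \<Longrightarrow> monom_degree e = M - (n + d\<^sub>0)"
    using potential_pvar_power[OF pot hom' k_less] by blast
  have "y k ^ M = (\<Sum>j<n + 1. peval y (h j) * peval y (pderivative j \<Omega>))"
    using arg_cong[OF M(2), of "peval y"] by (simp only: peval_power peval_pvar peval_sum peval_mult)
  moreover have "vge (\<Sum>j<n + 1. peval y (h j) * peval y (pderivative j \<Omega>)) (int (M - (n + d\<^sub>0)) * a + int n * a)"
    by (intro vge_sum vge_mult vge_gradient vge_peval[where m = "n + 1"] y_ge) (use h y_ge in auto)
  ultimately have "vge (y k ^ M) (int (M - (n + d\<^sub>0)) * a + int n * a)"
    by (simp only:)
  then have "int (M - (n + d\<^sub>0)) * a + int n * a \<le> int M * a"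
    using k_nz by (simp add: vge_def v_power a_def)
  then have "int d\<^sub>0 * a \<ge> 0"
    using M(1) by (simp add: of_nat_diff algebra_simps)
  then show False
    using a d\<^sub>0 by (simp add: zero_le_mult_iff)
qed

text \<open>If all partial derivatives at \<open>y\<close> had value at least 1, so would the Euler
  sum. That sum is a nonzero scalar, of value 0, because the degree is invertible in characteristic
  0.\<close>

lemma unit_gradient:
  obtains b where "b < n + 1" "peval y (pderivative b \<Omega>) \<noteq> 0" "v (peval y (pderivative b \<Omega>)) = 0"
proof -
  have "\<exists>b<n + 1. \<not> vge (peval y (pderivative b \<Omega>)) 1"
  proof (rule ccontr)
    assume "\<not> ?thesis"
    then have "vge (\<Sum>b<n + 1. y b * peval y (pderivative b \<Omega>)) (0 + 1)"
      by (intro vge_sum vge_mult coordinates_nonnegative) auto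
    moreover have "(\<Sum>b<n + 1. y b * peval y (pderivative b \<Omega>)) = scale (of_nat (n + 1 + d\<^sub>0) * \<xi>) 1"
      using arg_cong[OF euler_homogeneous[OF hom \<Omega>_ring], of "peval y"]
      by (simp only: peval_sum peval_mult peval_pvar peval_pconst y_\<Omega> scale_one_mult scale_scale)
    moreover have "v (scale (of_nat (n + 1 + d\<^sub>0) * \<xi>) 1) = 0"
      using \<xi> by (intro v_scalar) (simp del: of_nat_add of_nat_Suc)
    moreover have "scale (of_nat (n + 1 + d\<^sub>0) * \<xi>) 1 \<noteq> 0"
      using \<xi> by (simp del: of_nat_add of_nat_Suc)
    ultimately show False
      by (simp add: vge_def)
  qed
  then obtain b where b: "b < n + 1" "\<not> vge (peval y (pderivative b \<Omega>)) 1"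
    by blast
  then show ?thesis
    using vge_gradient[of 0 b] coordinates_nonnegative by (intro that[of b]) (auto simp: vge_def)
qed

text \<open>
  A polynomial with constant \<open>t\<^sub>b\<close>-exponent \<open>j\<close> is \<open>t\<^sub>b\<^sup>j\<close> times a polynomial in the other variables,
  and the substitution \<open>t\<^sub>b := 1\<close> evaluates that second factor.
\<close>

lemma v_peval_eq_0:
  assumes b: "b < n + 1" "peval y (pderivative b \<Omega>) \<noteq> 0" "v (peval y (pderivative b \<Omega>)) = 0"
    and G: "G \<in> poly_ring (n + 1)" "G \<noteq> 0"
    and "\<And>e. e \<in> Poly_Mapping.keys G \<Longrightarrow> Poly_Mapping.lookup e b = j"
    and "\<And>e. e \<in> Poly_Mapping.keys G \<Longrightarrow> monom_degree e \<le> d"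
  shows "peval (y(b := 1)) G \<noteq> 0 \<and> v (peval (y(b := 1)) G) = 0"
  using G assms(6,7)
proof (induction d arbitrary: G rule: less_induct)
  case (less d)
  let ?y = "y(b := 1)"
  have y_ge: "vge (?y i) 0" if "i < n + 1" for i
    using coordinates_nonnegative[OF that] by (simp add: vge_def)
  have ge: "vge (peval ?y G) 0"
    by (rule vge_peval[OF y_ge less.prems(1)]) auto
  show ?case
  proof (cases "\<exists>a<n + 1. a \<noteq> b \<and> pderivative a G \<noteq> 0")
    case True
    then obtain a where a: "a < n + 1" "a \<noteq> b" "pderivative a G \<noteq> 0"
      by blast
    then obtain s where s: "s < n" "skip b s = a"
      using skip_surj[of a n b] b(1) by auto
    define us where "us = map (\<lambda>i. y (skip b i)) [0..<n]"
    have us: "length us = n" "\<And>i. i < n \<Longrightarrow> us ! i = y (skip b i)"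
      by (simp_all add: us_def)
    \<comment> \<open>Slot \<open>s\<close> held the coordinate of index \<open>a\<close>; the
      remaining slots hold the coordinates of index other than \<open>a\<close> and
      \<open>b\<close>.\<close>
    let ?D = "\<lambda>z. br (us[s := z])"
    have D: "derivation ?D"
      by (rule derivation_br[OF us(1) s(1)])
    have key: "e + Poly_Mapping.single a 1 \<in> Poly_Mapping.keys G"
      if "e \<in> Poly_Mapping.keys (pderivative a G)" for e
      by (rule keys_pderivative[OF that])
    have "d > 0"
    proof -
      obtain e where e: "e \<in> Poly_Mapping.keys (pderivative a G)"
        using a(3) by (metis all_not_in_conv keys_eq_empty)
      then show ?thesis
        using less.prems(4)[OF key[OF e]] by (simp add: monom_degree_add)
    qed
    have IH: "peval ?y (pderivative a G) \<noteq> 0 \<and> v (peval ?y (pderivative a G)) = 0"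
    proof (rule less.IH[of "d - 1"])
      show "Poly_Mapping.lookup e b = j" if "e \<in> Poly_Mapping.keys (pderivative a G)" for e
        using less.prems(3)[OF key[OF that]] a(2) by (simp add: lookup_add lookup_single)
      show "monom_degree e \<le> d - 1" if "e \<in> Poly_Mapping.keys (pderivative a G)" for e
        using less.prems(4)[OF key[OF that]] by (simp add: monom_degree_add)
    qed (use \<open>d > 0\<close> a less.prems in \<open>auto intro: poly_ring_pderivative\<close>)
    \<comment> \<open>A coordinate other than \<open>a\<close> and \<open>b\<close> repeats a slot,
      and coordinate \<open>b\<close> has been replaced by the constant 1; the derivation kills
      both.\<close>
    have D_other: "?D (?y i) = 0" if i: "i < n + 1" "i \<noteq> a" for i
    proof (cases "i = b")
      case False
      then obtain s' where "s' < n" "skip b s' = i"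
        using skip_surj[of i n b] b(1) i by auto
      then show ?thesis
        using br_repeated[OF us(1) s(1), of s'] i(2) s(2) us(2)[of s'] False by auto
    qed (simp add: derivation_one[OF D])
    have "us[s := ?y a] = us"
      using s a us(2)[of s] by (simp add: list_update_same_conv us(1))
    then have D_a: "?D (?y a) \<in> {peval y (pderivative b \<Omega>), - peval y (pderivative b \<Omega>)}"
      using br_y[of b] b(1) by (simp add: us_def)
    have "?D (peval ?y G) = (\<Sum>i<n + 1. peval ?y (pderivative i G) * ?D (?y i))"
      by (rule derivation_peval[OF D less.prems(1)])
    also have "\<dots> = (\<Sum>i<n + 1. if i = a then peval ?y (pderivative a G) * ?D (?y a) else 0)"
      by (rule sum.cong) (use D_other in auto)
    also have "\<dots> = peval ?y (pderivative a G) * ?D (?y a)"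
      using a(1) by simp
    finally have DG: "?D (peval ?y G) = peval ?y (pderivative a G) * ?D (?y a)" .
    have "?D (?y a) \<noteq> 0" and "v (?D (?y a)) = 0"
      using D_a b(2,3) v_mult[of "- 1" "peval y (pderivative b \<Omega>)"] v_scalar[of "- 1"] by auto
    then have DG_nz: "?D (peval ?y G) \<noteq> 0" and v_DG: "v (?D (peval ?y G)) = 0"
      unfolding DG using IH by (auto simp: v_mult)
    have nz: "peval ?y G \<noteq> 0"
      using DG_nz derivation_zero[OF D] by auto
    \<comment> \<open>The other slots have nonnegative value, so the bracket has at least the value
      of \<open>peval ?y G\<close>. As the bracket has value 0, this is the upper bound
      sought.\<close>
    have "vge (br (us[s := peval ?y G])) (\<Sum>i<n. if i = s then v (peval ?y G) else 0)"
    proof (rule vge_br)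
      show "vge (us[s := peval ?y G] ! i) (if i = s then v (peval ?y G) else 0)" if "i < n" for i
        using that coordinates_nonnegative[of "skip b i"] skip_less[OF that, of b]
        by (auto simp: us nth_list_update vge_self)
    qed (simp add: us)
    then have "v (peval ?y G) \<le> 0"
      using DG_nz v_DG s(1) by (simp add: vge_def)
    moreover have "0 \<le> v (peval ?y G)"
      using ge nz by (auto simp only: vge_def)
    ultimately show ?thesis
      using nz by linarith
  next
    case False
    \<comment> \<open>No variable other than that of index \<open>b\<close> occurs, so
      \<open>G\<close> is a single term in it, which the substitution turns into a nonzero
      scalar.\<close>
    have "e = Poly_Mapping.single b j" if e: "e \<in> Poly_Mapping.keys G" for e
    proof (rule poly_mapping_eqI)
      fix i
      show "Poly_Mapping.lookup e i = Poly_Mapping.lookup (Poly_Mapping.single b j) i"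
      proof (cases "i = b")
        case True
        then show ?thesis
          using less.prems(3)[OF e] by simp
      next
        case i: False
        have "Poly_Mapping.lookup e i = 0"
        proof (cases "i < n + 1")
          case True
          then show ?thesis
            using False i pderivative_eq_0D[OF _ e] by blast
        next
          case False
          then show ?thesis
            using less.prems(1) e by (auto simp: poly_ring_def in_keys_iff subset_iff)
        qed
        then show ?thesis
          using i by (simp add: lookup_single)
      qed
    qed
    then have "Poly_Mapping.keys G = {Poly_Mapping.single b j}"
      using less.prems(2) by (metis insertI1 is_singletonI' is_singleton_the_elem keys_eq_empty singletonD)
    then have eq: "peval ?y G = scale (Poly_Mapping.lookup G (Poly_Mapping.single b j)) 1"
      and c: "Poly_Mapping.lookup G (Poly_Mapping.single b j) \<noteq> 0"
      by (auto simp: peval_def in_keys_iff[symmetric])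
    show ?thesis
      unfolding eq using c by (simp add: v_scalar)
  qed
qed

text \<open>Coordinate \<open>b\<close> is replaced by \<open>z\<close>. Sorting a polynomial by its
  exponent j in that variable gives terms z^j u_j with u_j of value 0. Their values j v(z) are
  pairwise different, so the \<open>n + 1\<close> elements are algebraically independent.\<close>

lemma GKdim_ge_Suc:
  assumes z: "z \<noteq> 0" "v z \<noteq> 0"
  shows "ereal (real (n + 1)) \<le> GKdim"
proof -
  obtain b where b: "b < n + 1" "peval y (pderivative b \<Omega>) \<noteq> 0" "v (peval y (pderivative b \<Omega>)) = 0"
    by (rule unit_gradient)
  have split: "peval (y(b := z)) G = z ^ j * peval (y(b := 1)) G"
    if "\<And>e. e \<in> Poly_Mapping.keys G \<Longrightarrow> Poly_Mapping.lookup e b = j" for G j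
  proof -
    have "monom_eval (y(b := z)) e = z ^ j * monom_eval (y(b := 1)) e" if "Poly_Mapping.lookup e b = j" for e
    proof -
      let ?A = "insert b (Poly_Mapping.keys e)"
      have "monom_eval (y(b := c)) e = c ^ j * (\<Prod>i\<in>?A - {b}. y i ^ Poly_Mapping.lookup e i)" for c
      proof -
        have "monom_eval (y(b := c)) e = (\<Prod>i\<in>?A. (y(b := c)) i ^ Poly_Mapping.lookup e i)"
          by (rule monom_eval_superset) auto
        also have "\<dots> = c ^ j * (\<Prod>i\<in>?A - {b}. (y(b := c)) i ^ Poly_Mapping.lookup e i)"
          using that by (subst prod.remove[of _ b]) auto
        also have "(\<Prod>i\<in>?A - {b}. (y(b := c)) i ^ Poly_Mapping.lookup e i) = (\<Prod>i\<in>?A - {b}. y i ^ Poly_Mapping.lookup e i)"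
          by (rule prod.cong) auto
        finally show ?thesis .
      qed
      then show ?thesis
        by simp
    qed
    then show ?thesis
      using that by (simp add: peval_def sum_distrib_left scale_mult_right)
  qed
  have "peval (y(b := z)) H \<noteq> 0" if H: "H \<in> poly_ring (n + 1)" "H \<noteq> 0" for H
  proof -
    define J where "J = (\<lambda>e. Poly_Mapping.lookup e b) ` Poly_Mapping.keys H"
    define part where "part j = mpart (\<lambda>e. Poly_Mapping.lookup e b = j) H" for j
    have J: "finite J" "J \<noteq> {}"
      using H(2) by (simp_all add: J_def)
    have H_sum: "H = (\<Sum>j\<in>J. part j)"
    proof (rule poly_mapping_eqI)
      fix e
      show "Poly_Mapping.lookup H e = Poly_Mapping.lookup (\<Sum>j\<in>J. part j) e"
        using J(1) by (auto simp: lookup_sum part_def lookup_mpart J_def in_keys_iff)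
    qed
    have part: "peval (y(b := 1)) (part j) \<noteq> 0 \<and> v (peval (y(b := 1)) (part j)) = 0" if "j \<in> J" for j
    proof (rule v_peval_eq_0[OF b])
      show "part j \<in> poly_ring (n + 1)"
        using H(1) by (simp add: part_def poly_ring_mpart)
      show "part j \<noteq> 0"
        using that by (auto simp: part_def J_def keys_mpart simp flip: keys_eq_empty)
      show "Poly_Mapping.lookup e b = j" if "e \<in> Poly_Mapping.keys (part j)" for e
        using that by (simp add: part_def keys_mpart)
      show "monom_degree e \<le> Max (monom_degree ` Poly_Mapping.keys (part j))"
        if "e \<in> Poly_Mapping.keys (part j)" for e
        using that by simp
    qed
    have "(\<Sum>j\<in>J. z ^ j * peval (y(b := 1)) (part j)) \<noteq> 0"
    proof (rule sum_distinct_valuations_nonzero[OF J])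
      show "inj_on (\<lambda>j. v (z ^ j * peval (y(b := 1)) (part j))) J"
        using part z by (auto intro!: inj_onI simp: v_mult v_power)
    qed (use part z in auto)
    also have "(\<Sum>j\<in>J. z ^ j * peval (y(b := 1)) (part j)) = peval (y(b := z)) H"
      by (subst H_sum, subst peval_sum, rule sum.cong) (auto simp: part_def keys_mpart intro!: split[symmetric])
    finally show ?thesis .
  qed
  then show ?thesis
    by (intro GKdim_ge_of_algebraically_independent) auto
qed

end

end

section \<open>Zero-valuations and morphisms\<close>

lemma zero_valuation_imp_nambu_valuation:
  fixes scale :: "'k::field_char_0 \<Rightarrow> 'a::field \<Rightarrow> 'a"
  assumes "nambu_poisson_algebra scale n br" and zv: "zero_valuation n scale br \<nu>"
  obtains v where "nambu_valuation scale v n br" "\<And>x. x \<noteq> 0 \<Longrightarrow> \<nu> x = ereal (real_of_int (v x))"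
proof -
  interpret nambu_poisson_algebra scale n br by fact
  \<comment> \<open>The floor recovers the integer exactly at nonzero \<open>x\<close>; at 0 the
    conversion from infinity gives the default 0.\<close>
  define v where "v x = \<lfloor>real_of_ereal (\<nu> x)\<rfloor>" for x
  have range: "\<nu> x \<in> insert \<infinity> (range (\<lambda>z::int. ereal (real_of_int z)))"
    and infty: "\<nu> x = \<infinity> \<longleftrightarrow> x = 0"
    and scalar: "c \<noteq> 0 \<Longrightarrow> \<nu> (scale c 1) = 0"
    and mult: "\<nu> (x * y) = \<nu> x + \<nu> y"
    and add: "min (\<nu> x) (\<nu> y) \<le> \<nu> (x + y)"
    and brk: "length us = n \<Longrightarrow> sum_list (map \<nu> us) \<le> \<nu> (br us)" for x y c us
    using zv unfolding zero_valuation_def by blast+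
  have \<nu>: "\<nu> x = ereal (real_of_int (v x))" if "x \<noteq> 0" for x
    using range[of x] infty[of x] that by (auto simp: v_def)
  interpret int_valuation scale v
  proof unfold_locales
    show "v (x * y) = v x + v y" if "x \<noteq> 0" "y \<noteq> 0" for x y
      using mult[of x y] that by (simp add: \<nu> flip: of_int_add)
    show "min (v x) (v y) \<le> v (x + y)" if "x \<noteq> 0" "y \<noteq> 0" "x + y \<noteq> 0" for x y
      using add[of x y] that by (simp add: \<nu> min_def split: if_splits)
    show "v (scale c 1) = 0" if "c \<noteq> 0" for c
      using scalar[OF that] that \<nu>[of "scale c 1"] by simp
  qed
  have "nambu_valuation scale v n br"
  proof unfold_locales
    fix us :: "'a list"
    assume us: "length us = n" "\<And>s. s < n \<Longrightarrow> us ! s \<noteq> 0"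
    have "sum_list (map \<nu> us) = (\<Sum>s<n. ereal (real_of_int (v (us ! s))))"
      using us by (simp add: sum_list_sum_nth atLeast0LessThan \<nu>)
    then show "vge (br us) (\<Sum>s<n. v (us ! s))"
      using brk[OF us(1)] by (cases "br us = 0") (simp_all add: \<nu> vge_def flip: of_int_sum)
  qed
  then show ?thesis
    using \<nu> by (rule that)
qed

text \<open>The locale provides only the inequality for sums; equality for distinct values has to be
  derived from it.\<close>

lemma (in nambu_valuation) zero_valuation:
  "zero_valuation n scale br (\<lambda>x. if x = 0 then \<infinity> else ereal (real_of_int (v x)))"
proof -
  let ?\<nu> = "\<lambda>x. if x = 0 then \<infinity> else ereal (real_of_int (v x))"
  have le: "min (?\<nu> a) (?\<nu> b) \<le> ?\<nu> (a + b)" for a b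
    using v_add[of a b] by (auto simp: min_def split: if_splits)
  have uminus: "?\<nu> (- b) = ?\<nu> b" for b
    using v_mult[of "- 1" b] v_scalar[of "- 1"] by auto
  have eq: "?\<nu> (a + b) = ?\<nu> a" if "?\<nu> a < ?\<nu> b" for a b
  proof (rule antisym)
    show "?\<nu> a \<le> ?\<nu> (a + b)"
      using le[of a b] that by (simp only: min.absorb3)
    \<comment> \<open>The inequality for \<open>a = (a + b) + (- b)\<close>: since \<open>b\<close>
      has larger value than \<open>a\<close>, the bound must come from \<open>a + b\<close>.\<close>
    have "min (?\<nu> (a + b)) (?\<nu> b) \<le> ?\<nu> a"
      using le[of "a + b" "- b"] uminus[of b] by (simp only: add_uminus_conv_diff add_diff_cancel)
    then show "?\<nu> (a + b) \<le> ?\<nu> a"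
      using that by (meson leD min_le_iff_disj)
  qed
  have "?\<nu> (a + b) = min (?\<nu> a) (?\<nu> b)" if "?\<nu> a \<noteq> ?\<nu> b" for a b
  proof (cases "?\<nu> a < ?\<nu> b")
    case True
    then show ?thesis
      unfolding eq[OF True] by (simp only: min.absorb3)
  next
    case False
    have "?\<nu> b < ?\<nu> a"
      by (rule le_neq_trans[OF leI[OF False] that[symmetric]])
    then show ?thesis
      using eq[of b a] by (simp only: add.commute min.absorb4)
  qed
  moreover have "sum_list (map ?\<nu> us) \<le> ?\<nu> (br us)" if us: "length us = n" for us
  proof (cases "\<forall>s<n. us ! s \<noteq> 0")
    case True
    then have "sum_list (map ?\<nu> us) = (\<Sum>s<n. ereal (real_of_int (v (us ! s))))"
      using us by (simp add: sum_list_sum_nth atLeast0LessThan)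
    then show ?thesis
      using v_br[of us] us True by (auto simp: vge_def simp flip: of_int_sum)
  next
    case False
    then show ?thesis
      using br_eq_0[OF us] by auto
  qed
  moreover have "?\<nu> (a * b) = ?\<nu> a + ?\<nu> b" for a b
    using v_mult[of a b] by auto
  ultimately show ?thesis
    unfolding zero_valuation_def using le by (auto simp: v_scalar)
qed

text \<open>The images of the variables satisfy the relations studied above, which forces
  GK-dimension at least \<open>n + 1\<close> on the target.\<close>

lemma no_morphism_if_nontrivial_valuation:
  fixes \<Omega> :: "'k::field_char_0 mpoly"
    and scaleN :: "'k \<Rightarrow> 'a::field \<Rightarrow> 'a" and scaleK :: "'k \<Rightarrow> 'b::field \<Rightarrow> 'b"
  assumes "d\<^sub>0 > 0" "is_potential (n + 1) \<Omega>" "homogeneous_of_degree (n + 1 + d\<^sub>0) \<Omega>" "\<xi> \<noteq> 0"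
    and N: "is_Q_P n \<Omega> \<xi> scaleN brN" and K: "nambu_poisson_algebra scaleK n brK"
    and GK: "comm_algebra.GKdim scaleK = ereal (real n)"
    and \<nu>: "\<nu> \<in> nontrivial_zero_valuations n scaleK brK"
    and \<theta>: "nambu_poisson_morphism n scaleN brN scaleK brK \<theta>"
  shows False
proof -
  have "zero_valuation n scaleK brK \<nu>"
    using \<nu> by (simp add: nontrivial_zero_valuations_def)
  from zero_valuation_imp_nambu_valuation[OF K this] obtain v
    where v: "nambu_valuation scaleK v n brK" "\<And>x. x \<noteq> 0 \<Longrightarrow> \<nu> x = ereal (real_of_int (v x))"
    by blast
  interpret nambu_valuation scaleK v n brK by fact
  interpret N: nambu_poisson_algebra scaleN n brN
    using N by (simp add: is_Q_P_def)
  let ?R = "poly_ring (n + 1) :: 'k mpoly set"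
  obtain \<pi> where \<pi>: "fraction_field_via (n + 1) (principal_ideal (n + 1) (\<Omega> - pconst \<xi>)) scaleN \<pi>"
    and br: "\<And>fs. length fs = n \<Longrightarrow> set fs \<subseteq> ?R \<Longrightarrow> brN (map \<pi> fs) = \<pi> (jacobian_bracket n \<Omega> fs)"
    using N by (auto simp: is_Q_P_def)
  have \<pi>_hom: "\<pi> 1 = 1" "\<And>f g. f \<in> ?R \<Longrightarrow> g \<in> ?R \<Longrightarrow> \<pi> (f + g) = \<pi> f + \<pi> g"
    "\<And>f g. f \<in> ?R \<Longrightarrow> g \<in> ?R \<Longrightarrow> \<pi> (f * g) = \<pi> f * \<pi> g"
    "\<And>c f. f \<in> ?R \<Longrightarrow> \<pi> (pconst c * f) = scaleN c (\<pi> f)"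
    "\<And>f. f \<in> ?R \<Longrightarrow> \<pi> f = 0 \<longleftrightarrow> f \<in> principal_ideal (n + 1) (\<Omega> - pconst \<xi>)"
    using \<pi> unfolding fraction_field_via_def by blast+
  have \<theta>_hom: "\<theta> 1 = 1" "\<And>x y. \<theta> (x + y) = \<theta> x + \<theta> y" "\<And>x y. \<theta> (x * y) = \<theta> x * \<theta> y"
    "\<And>c x. \<theta> (scaleN c x) = scaleK c (\<theta> x)" "\<And>us. length us = n \<Longrightarrow> \<theta> (brN us) = brK (map \<theta> us)"
    using \<theta> unfolding nambu_poisson_morphism_def by blast+
  define y where "y i = \<theta> (\<pi> (pvar i))" for i
  have \<theta>\<pi>: "\<theta> (\<pi> f) = peval y f" if "f \<in> ?R" for f
    unfolding y_def
    by (rule ring_hom_eq_peval[of "\<lambda>f. \<theta> (\<pi> f)", OF _ _ _ _ that]) (simp_all only: \<pi>_hom \<theta>_hom)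
  have \<Omega>_ring: "\<Omega> \<in> ?R"
    using assms(2) by (simp add: is_potential_def)
  \<comment> \<open>The generator of the ideal dies in the quotient; this becomes the relation
    \<Omega>(y) = \<xi>.\<close>
  have "\<Omega> - pconst \<xi> \<in> principal_ideal (n + 1) (\<Omega> - pconst \<xi>)"
    unfolding principal_ideal_def by (rule CollectI, rule exI[of _ 1]) simp
  then have "\<pi> (\<Omega> - pconst \<xi>) = 0"
    using \<pi>_hom(5) \<Omega>_ring by (simp add: poly_ring_diff)
  moreover have "\<theta> 0 = 0"
    using \<theta>_hom(2)[of 0 0] by (metis add_0 add_cancel_right_right)
  ultimately have y_\<Omega>: "peval y \<Omega> = scaleK \<xi> 1"
    using \<theta>\<pi>[of "\<Omega> - pconst \<xi>"] \<Omega>_ring by (simp add: poly_ring_diff peval_diff)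
  have br_y: "brK (map (\<lambda>i. y (skip b i)) [0..<n]) \<in>
      {peval y (pderivative b \<Omega>), - peval y (pderivative b \<Omega>)}" if b: "b \<le> n" for b
  proof -
    let ?fs = "map (\<lambda>i. pvar (skip b i)) [0..<n] :: 'k mpoly list"
    have fs: "length ?fs = n" "set ?fs \<subseteq> ?R"
      using skip_less[of _ n b] by auto
    have "brK (map (\<lambda>i. y (skip b i)) [0..<n]) = \<theta> (brN (map \<pi> ?fs))"
      by (simp add: \<theta>_hom y_def comp_def)
    also have "\<dots> = \<theta> (\<pi> (jacobian_bracket n \<Omega> ?fs))"
      using br[OF fs] by simp
    also have "\<dots> = peval y (jacobian_bracket n \<Omega> ?fs)"
      using jacobian_bracket_skip[OF b, of \<Omega>] poly_ring_pderivative[OF \<Omega>_ring, of b]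
      by (intro \<theta>\<pi>) (auto simp: poly_ring_uminus)
    finally show ?thesis
      using jacobian_bracket_skip[OF b, of \<Omega>] by (auto simp: peval_uminus)
  qed
  obtain z where z: "z \<noteq> 0" "\<nu> z \<noteq> 0"
    using \<nu> by (auto simp: nontrivial_zero_valuations_def trivial_valuation_def)
  then have "v z \<noteq> 0"
    using v(2)[of z] by auto
  then have "ereal (real (n + 1)) \<le> GKdim"
    using GKdim_ge_Suc[OF assms(2,3,1,4) y_\<Omega> br_y z(1)] by blast
  then show False
    using GK by simp
qed

text \<open>Polarization: the bracket with \<open>us ! i + us ! j\<close> in both slots vanishes,
  and expanding it leaves the two mixed terms.\<close>

lemma (in nambu_poisson_algebra) br_swap:
  assumes us: "length us = n" and ij: "i < n" "j < n" "i \<noteq> j"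
  shows "br (us[i := us ! j, j := us ! i]) = - br us"
proof -
  define f where "f a b = br (us[i := a, j := b])" for a b
  have f_add1: "f (a + b) c = f a c + f b c" for a b c
    using br_add[of "us[j := c]" i a b] us ij by (simp add: f_def list_update_swap[of i j])
  have f_add2: "f c (a + b) = f c a + f c b" for a b c
    using br_add[of "us[i := c]" j a b] us ij by (simp add: f_def)
  have f_same: "f a a = 0" for a
    unfolding f_def using us ij by (intro br_alternating[of _ i j]) (auto simp: nth_list_update)
  have "f (us ! i + us ! j) (us ! i + us ! j) = f (us ! i) (us ! j) + f (us ! j) (us ! i)"
    by (simp only: f_add1 f_add2) (simp add: f_same)
  then have "f (us ! j) (us ! i) = - f (us ! i) (us ! j)"
    by (simp add: f_same eq_neg_iff_add_eq_0 add.commute)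
  then show ?thesis
    by (simp add: f_def)
qed

text \<open>Each transposition changes the sign; the total sign is not tracked, since a valuation
  ignores it.\<close>

lemma (in nambu_poisson_algebra) br_permute:
  assumes "p permutes {..<n}" "length us = n"
  shows "br (map (\<lambda>i. us ! p i) [0..<n]) \<in> {br us, - br us}"
  using assms(1) finite_lessThan assms(2)
proof (induction p arbitrary: us rule: permutes_induct)
  case id
  then show ?case
    using map_nth[of us] by auto
next
  case (swap a b p)
  let ?us = "us[a := us ! b, b := us ! a]"
  have eq: "map (\<lambda>i. us ! (transpose a b \<circ> p) i) [0..<n] = map (\<lambda>i. ?us ! p i) [0..<n]"
  proof (rule map_cong[OF refl])
    fix i assume "i \<in> set [0..<n]"
    then have "p i < n"
      using permutes_in_image[OF swap.hyps(4), of i] by auto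
    then show "us ! (transpose a b \<circ> p) i = ?us ! p i"
      using swap by (auto simp: nth_list_update transpose_def)
  qed
  have "br (map (\<lambda>i. ?us ! p i) [0..<n]) \<in> {br ?us, - br ?us}"
    by (rule swap.IH) (use swap.prems in simp)
  moreover have "br ?us = - br us"
    using swap by (intro br_swap) auto
  ultimately show ?case
    unfolding eq by auto
qed

section \<open>The degree valuation\<close>

text \<open>In the permutation expansion of the determinant, each term takes 0 or 1 from each of the
  first \<open>n\<close> rows and one partial derivative of \<Omega> from the last.\<close>

lemma jacobian_bracket_pvar_degree:
  assumes \<Omega>: "\<Omega> \<in> poly_ring (n + 1)" "homogeneous_of_degree (Suc N) \<Omega>"
    and len: "length is = n"
  shows "jacobian_bracket n \<Omega> (map pvar is) \<in> poly_ring (n + 1) \<and>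
    (\<forall>e\<in>Poly_Mapping.keys (jacobian_bracket n \<Omega> (map pvar is)). monom_degree e \<le> N)"
proof -
  define Bd :: "nat \<Rightarrow> 'a mpoly set"
    where "Bd d = {p \<in> poly_ring (n + 1). \<forall>e\<in>Poly_Mapping.keys p. monom_degree e \<le> d}" for d
  have Bd_sum: "sum f A \<in> Bd d" if "\<And>i. i \<in> A \<Longrightarrow> f i \<in> Bd d" for d A and f :: "(nat \<Rightarrow> nat) \<Rightarrow> 'a mpoly"
    using that keys_sum[of f A] unfolding Bd_def by (fastforce intro: poly_ring_sum)
  have Bd_mult: "p * q \<in> Bd (d + d')" if "p \<in> Bd d" "q \<in> Bd d'" for p q d d'
  proof -
    have "monom_degree e \<le> d + d'" if e: "e \<in> Poly_Mapping.keys (p * q)" for e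
    proof -
      obtain e1 e2 where "e = e1 + e2" "e1 \<in> Poly_Mapping.keys p" "e2 \<in> Poly_Mapping.keys q"
        using e keys_mult[of p q] by blast
      then show ?thesis
        using \<open>p \<in> Bd d\<close> \<open>q \<in> Bd d'\<close> by (auto simp: Bd_def monom_degree_add intro: add_mono)
    qed
    then show ?thesis
      using that by (auto simp: Bd_def poly_ring_mult)
  qed
  have Bd_prod: "prod f A \<in> Bd 0" if "\<And>i. i \<in> A \<Longrightarrow> f i \<in> Bd 0" for A and f :: "nat \<Rightarrow> 'a mpoly"
    using that
  proof (induction A rule: infinite_finite_induct)
    case (insert a A)
    then show ?case
      using Bd_mult[of "f a" 0 "prod f A" 0] by simp
  qed (auto simp: Bd_def)
  define M where "M = mat (n + 1) (n + 1) (\<lambda>(i, j). pderivative j ((map pvar is @ [\<Omega>]) ! i))"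
  have M: "M \<in> carrier_mat (n + 1) (n + 1)"
    by (simp add: M_def)
  have "det M \<in> Bd N"
    unfolding det_def'[OF M]
  proof (rule Bd_sum)
    fix p assume "p \<in> {p. p permutes {0..<n + 1}}"
    then have p: "p i < n + 1" if "i < n + 1" for i
      using that permutes_in_image[of p "{0..<n + 1}" i] by auto
    have "(\<Prod>i = 0..<n. M $$ (i, p i)) \<in> Bd 0"
    proof (rule Bd_prod)
      fix i assume "i \<in> {0..<n}"
      then have "M $$ (i, p i) = (if is ! i = p i then 1 else 0)"
        using p[of i] len by (auto simp: M_def nth_append pderivative_pvar)
      then show "M $$ (i, p i) \<in> Bd 0"
        by (simp add: Bd_def)
    qed
    moreover have "M $$ (n, p n) = pderivative (p n) \<Omega>"
      using p[of n] len by (auto simp: M_def nth_append)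
    then have "M $$ (n, p n) \<in> Bd N"
      using \<Omega> homogeneous_pderivative[OF \<Omega>(2)] by (auto simp: Bd_def poly_ring_pderivative)
    moreover have "(signof p :: 'a mpoly) \<in> Bd 0"
      by (auto simp: sign_def Bd_def poly_ring_uminus)
    ultimately have "signof p * ((\<Prod>i = 0..<n. M $$ (i, p i)) * M $$ (n, p n)) \<in> Bd (0 + (0 + N))"
      by (intro Bd_mult)
    then show "signof p * (\<Prod>i = 0..<n + 1. M $$ (i, p i)) \<in> Bd N"
      by simp
  qed
  then show ?thesis
    by (simp add: jacobian_bracket_def M_def Bd_def)
qed

text \<open>By \<open>hpart_I\<close>, the homogeneous components of an element of \<open>I\<close>
  lie in \<open>I\<close>, so the grading by degree descends to the quotient.\<close>

locale graded_fraction_field = comm_algebra scale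
  for scale :: "'k::field_char_0 \<Rightarrow> 'a::field \<Rightarrow> 'a" +
  fixes m :: nat and I and \<pi> :: "'k mpoly \<Rightarrow> 'a"
  assumes \<pi>: "fraction_field_via m I scale \<pi>"
    and hpart_I: "f \<in> I \<Longrightarrow> hpart d f \<in> I"
begin

definition x :: "nat \<Rightarrow> 'a" where
  "x i = \<pi> (pvar i)"

lemma \<pi>_eq_peval: "f \<in> poly_ring m \<Longrightarrow> \<pi> f = peval x f"
  unfolding x_def
  by (rule ring_hom_eq_peval[of \<pi>]) (use \<pi> in \<open>auto simp: fraction_field_via_def\<close>)

lemma peval_eq_0_iff: "f \<in> poly_ring m \<Longrightarrow> peval x f = 0 \<longleftrightarrow> f \<in> I"
  using \<pi> by (simp add: fraction_field_via_def flip: \<pi>_eq_peval)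

lemma ex_fraction: "\<exists>f g. f \<in> poly_ring m \<and> g \<in> poly_ring m \<and> peval x g \<noteq> 0 \<and> z = peval x f / peval x g"
  using \<pi> \<pi>_eq_peval unfolding fraction_field_via_def by metis

text \<open>The ring K[s] becomes an algebra over the base field, so that \<open>P.peval\<close> can
  evaluate polynomials in it.\<close>

sublocale P: comm_algebra "\<lambda>c p. smult (scale c 1) (p :: 'a Polynomial.poly)"
  by unfold_locales
    (simp_all add: smult_add_right smult_add_left scale_left_distrib scale_one_mult)

text \<open>
  \<open>graded_eval f = (\<Sum>d. \<pi> (f\<^sub>d) s\<^sup>d)\<close>, where \<open>f\<^sub>d\<close> is the homogeneous part of degree \<open>d\<close>. As \<open>I\<close> is
  homogeneous, this is injective on the quotient, and its values lie in the domain \<open>K[s]\<close>: this makes the degree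
  on the quotient additive under products.
\<close>

definition graded_eval :: "'k mpoly \<Rightarrow> 'a Polynomial.poly" where
  "graded_eval = P.peval (\<lambda>i. Polynomial.monom (x i) 1)"

lemma coeff_graded_eval: "Polynomial.coeff (graded_eval f) d = peval x (hpart d f)"
proof -
  have *: "monom_eval (\<lambda>i. Polynomial.monom (x i) 1) e = Polynomial.monom (monom_eval x e) (monom_degree e)" for e
  proof -
    have "(\<Prod>i\<in>A. Polynomial.monom (x i) 1 ^ Poly_Mapping.lookup e i) =
        Polynomial.monom (\<Prod>i\<in>A. x i ^ Poly_Mapping.lookup e i) (\<Sum>i\<in>A. Poly_Mapping.lookup e i)"
      if "finite A" for A
      using that by (induction A rule: finite_induct) (simp_all add: monom_power mult_monom)
    then show ?thesis
      by (simp add: monom_eval_def monom_degree_def)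
  qed
  have "Polynomial.coeff (graded_eval f) d =
      (\<Sum>e\<in>Poly_Mapping.keys f. if monom_degree e = d then scale (Poly_Mapping.lookup f e) (monom_eval x e) else 0)"
    unfolding graded_eval_def P.peval_def *
    by (simp add: coeff_sum scale_one_mult if_distrib cong: if_cong)
  also have "\<dots> = (\<Sum>e\<in>Poly_Mapping.keys (hpart d f). scale (Poly_Mapping.lookup f e) (monom_eval x e))"
    unfolding keys_mpart by (simp add: sum.inter_filter)
  also have "\<dots> = peval x (hpart d f)"
    unfolding peval_def by (rule sum.cong) (auto simp: keys_mpart lookup_mpart)
  finally show ?thesis .
qed

lemma graded_eval_mult: "graded_eval (f * g) = graded_eval f * graded_eval g"
  and graded_eval_add: "graded_eval (f + g) = graded_eval f + graded_eval g"
  and graded_eval_diff: "graded_eval (f - g) = graded_eval f - graded_eval g"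
  by (simp_all add: graded_eval_def P.peval_mult P.peval_add P.peval_diff)

text \<open>A polynomial is the sum of its homogeneous parts, which gives one direction; the other
  uses that \<open>I\<close> contains the parts of its elements.\<close>

lemma graded_eval_eq_0_iff:
  assumes "f \<in> poly_ring m"
  shows "graded_eval f = 0 \<longleftrightarrow> peval x f = 0"
proof
  assume "graded_eval f = 0"
  then have *: "peval x (hpart d f) = 0" for d
    using coeff_graded_eval[of f d] by simp
  have "f = (\<Sum>d\<le>Max (monom_degree ` Poly_Mapping.keys f). hpart d f)"
    by (rule sum_hpart[symmetric]) simp
  then have "peval x f = (\<Sum>d\<le>Max (monom_degree ` Poly_Mapping.keys f). peval x (hpart d f))"
    by (metis peval_sum)
  then show "peval x f = 0"
    by (simp add: *)
next
  assume "peval x f = 0"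
  then have "hpart d f \<in> I" for d
    using assms by (simp add: hpart_I peval_eq_0_iff)
  then show "graded_eval f = 0"
    using assms by (intro poly_eqI) (simp add: coeff_graded_eval peval_eq_0_iff poly_ring_mpart)
qed

lemma degree_graded_eval_le:
  assumes "\<And>e. e \<in> Poly_Mapping.keys f \<Longrightarrow> monom_degree e \<le> d"
  shows "Polynomial.degree (graded_eval f) \<le> d"
proof (rule degree_le, intro allI impI)
  fix i assume "d < i"
  then have "Poly_Mapping.keys (hpart i f) = {}"
    using assms by (fastforce simp: keys_mpart)
  then show "Polynomial.coeff (graded_eval f) i = 0"
    by (simp add: coeff_graded_eval)
qed

lemma minimal_representative:
  assumes f: "f \<in> poly_ring m"
  obtains f' where "f' \<in> poly_ring m" "peval x f' = peval x f"
    "\<And>e. e \<in> Poly_Mapping.keys f' \<Longrightarrow> monom_degree e \<le> Polynomial.degree (graded_eval f)"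
proof -
  let ?N = "Polynomial.degree (graded_eval f)"
  define f' where "f' = mpart (\<lambda>e. monom_degree e \<le> ?N) f"
  have "graded_eval f' = graded_eval f"
  proof (rule poly_eqI)
    fix d
    have "hpart d f' = (if d \<le> ?N then hpart d f else 0)"
      by (rule poly_mapping_eqI) (auto simp: f'_def lookup_mpart)
    moreover have "peval x (hpart d f) = 0" if "\<not> d \<le> ?N"
      using that coeff_eq_0[of "graded_eval f" d] by (simp add: coeff_graded_eval)
    ultimately show "Polynomial.coeff (graded_eval f') d = Polynomial.coeff (graded_eval f) d"
      by (simp add: coeff_graded_eval)
  qed
  moreover have f': "f' \<in> poly_ring m"
    using f by (simp add: f'_def poly_ring_mpart)
  ultimately have "peval x f' = peval x f"
    using graded_eval_eq_0_iff[of "f' - f"] f by (simp add: graded_eval_diff poly_ring_diff peval_diff)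
  then show ?thesis
    using f' by (intro that[of f']) (auto simp: f'_def keys_mpart)
qed

text \<open>An arbitrary choice of a fraction; \<open>v_fraction\<close> shows that the valuation
  does not depend on it.\<close>

definition num_den :: "'a \<Rightarrow> 'k mpoly \<times> 'k mpoly" where
  "num_den z = (SOME (f, g). f \<in> poly_ring m \<and> g \<in> poly_ring m \<and> peval x g \<noteq> 0 \<and>
     z = peval x f / peval x g)"

abbreviation "num z \<equiv> fst (num_den z)"
abbreviation "den z \<equiv> snd (num_den z)"

lemma num_den: "num z \<in> poly_ring m" "den z \<in> poly_ring m" "peval x (den z) \<noteq> 0"
  "peval x (num z) / peval x (den z) = z"
proof -
  have "\<exists>p. case p of (f, g) \<Rightarrow> f \<in> poly_ring m \<and> g \<in> poly_ring m \<and> peval x g \<noteq> 0 \<and> z = peval x f / peval x g"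
    using ex_fraction[of z] by auto
  then have "case num_den z of (f, g) \<Rightarrow> f \<in> poly_ring m \<and> g \<in> poly_ring m \<and> peval x g \<noteq> 0 \<and> z = peval x f / peval x g"
    unfolding num_den_def by (rule someI_ex)
  then show "num z \<in> poly_ring m" "den z \<in> poly_ring m" "peval x (den z) \<noteq> 0"
    "peval x (num z) / peval x (den z) = z"
    by (auto simp: case_prod_beta)
qed

definition v :: "'a \<Rightarrow> int" where
  "v z = int (Polynomial.degree (graded_eval (den z))) - int (Polynomial.degree (graded_eval (num z)))"

text \<open>Cross-multiplying two fractions for the same element gives an equality of products in
  the domain K[s], where degrees add.\<close>

lemma v_fraction:
  assumes f: "f \<in> poly_ring m" "peval x f \<noteq> 0" and g: "g \<in> poly_ring m" "peval x g \<noteq> 0"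
  shows "v (peval x f / peval x g) = int (Polynomial.degree (graded_eval g)) - int (Polynomial.degree (graded_eval f))"
proof -
  let ?z = "peval x f / peval x g"
  note nd = num_den[of ?z]
  have num_nz: "peval x (num ?z) \<noteq> 0"
    using nd(4) f g by force
  have "peval x (f * den ?z - num ?z * g) = 0"
    using nd(3,4) g(2) by (simp add: peval_diff peval_mult frac_eq_eq)
  then have "graded_eval f * graded_eval (den ?z) = graded_eval (num ?z) * graded_eval g"
    using graded_eval_eq_0_iff[of "f * den ?z - num ?z * g"] f g nd
    by (simp add: graded_eval_diff graded_eval_mult poly_ring_diff poly_ring_mult)
  then have "Polynomial.degree (graded_eval f) + Polynomial.degree (graded_eval (den ?z)) =
      Polynomial.degree (graded_eval (num ?z)) + Polynomial.degree (graded_eval g)"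
    using f g nd num_nz by (metis degree_mult_eq graded_eval_eq_0_iff)
  then show ?thesis
    by (simp add: v_def)
qed

sublocale int_valuation scale v
proof unfold_locales
  fix a b :: 'a assume ab: "a \<noteq> 0" "b \<noteq> 0"
  obtain f g where a: "f \<in> poly_ring m" "g \<in> poly_ring m" "peval x g \<noteq> 0" "a = peval x f / peval x g"
    using ex_fraction by blast
  obtain f' g' where b: "f' \<in> poly_ring m" "g' \<in> poly_ring m" "peval x g' \<noteq> 0" "b = peval x f' / peval x g'"
    using ex_fraction by blast
  have nz: "peval x f \<noteq> 0" "peval x f' \<noteq> 0"
    using ab a b by auto
  then have nz': "graded_eval f \<noteq> 0" "graded_eval g \<noteq> 0" "graded_eval f' \<noteq> 0" "graded_eval g' \<noteq> 0"
    using a b by (simp_all add: graded_eval_eq_0_iff)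
  have v_ab: "v a = int (Polynomial.degree (graded_eval g)) - int (Polynomial.degree (graded_eval f))"
    "v b = int (Polynomial.degree (graded_eval g')) - int (Polynomial.degree (graded_eval f'))"
    using a b nz by (simp_all add: v_fraction)
  have eq_mult: "a * b = peval x (f * f') / peval x (g * g')"
    using a b by (simp add: peval_mult)
  have "v (a * b) = int (Polynomial.degree (graded_eval (g * g'))) - int (Polynomial.degree (graded_eval (f * f')))"
    unfolding eq_mult using a b nz by (intro v_fraction) (simp_all add: poly_ring_mult peval_mult)
  then show "v (a * b) = v a + v b"
    using nz' by (simp add: v_ab graded_eval_mult degree_mult_eq)
  assume "a + b \<noteq> 0"
  moreover have eq: "a + b = peval x (f * g' + f' * g) / peval x (g * g')"
    using a b by (simp add: peval_mult peval_add add_frac_eq)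
  ultimately have "peval x (f * g' + f' * g) \<noteq> 0"
    by auto
  then have "v (a + b) = int (Polynomial.degree (graded_eval (g * g'))) -
      int (Polynomial.degree (graded_eval (f * g' + f' * g)))"
    unfolding eq using a b by (intro v_fraction) (simp_all add: poly_ring_mult poly_ring_add peval_mult)
  moreover have "Polynomial.degree (graded_eval f * graded_eval g' + graded_eval f' * graded_eval g) \<le>
      max (Polynomial.degree (graded_eval f) + Polynomial.degree (graded_eval g'))
        (Polynomial.degree (graded_eval f') + Polynomial.degree (graded_eval g))"
    using nz' by (metis degree_add_le_max degree_mult_eq)
  ultimately show "min (v a) (v b) \<le> v (a + b)"
    using nz' by (simp add: v_ab graded_eval_mult graded_eval_add degree_mult_eq)
next
  fix c :: 'k assume "c \<noteq> 0"
  moreover have "Polynomial.degree (graded_eval (pconst c)) = 0" for c :: 'k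
  proof -
    have "Polynomial.degree (graded_eval (pconst c)) \<le> 0"
      by (rule degree_graded_eval_le) (simp add: pconst_def split: if_splits)
    then show ?thesis by simp
  qed
  ultimately show "v (scale c 1) = 0"
    using v_fraction[of "pconst c" "pconst 1"] by simp
qed

lemma v_x: "i < m \<Longrightarrow> x i \<noteq> 0 \<Longrightarrow> v (x i) = - 1"
proof -
  assume i: "i < m" "x i \<noteq> 0"
  have "graded_eval (pvar i) = Polynomial.monom (x i) 1" "graded_eval 1 = 1"
    by (simp_all add: graded_eval_def)
  then show ?thesis
    using v_fraction[of "pvar i" 1] i by (simp add: degree_monom_eq)
qed

lemma vge_x: "i < m \<Longrightarrow> vge (x i) (- 1)"
  using v_x[of i] by (cases "x i = 0") (simp_all add: vge_def)

text \<open>Nonzero generators have value -1, so the hypothesis says that \<open>D\<close> shifts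
  their values by at least \<open>c\<close>. The chain rule carries this bound to polynomials and
  the Leibniz rule carries it to fractions.\<close>

lemma vge_derivation:
  assumes D: "derivation D" and D_x: "\<And>i. i < m \<Longrightarrow> vge (D (x i)) (c - 1)" and z: "z \<noteq> 0"
  shows "vge (D z) (v z + c)"
proof -
  have *: "vge (D (peval x f)) (c - int (Polynomial.degree (graded_eval f)))" if "f \<in> poly_ring m" for f
  proof -
    \<comment> \<open>Another polynomial with the same value could have larger degree, and
      differentiating it term by term would give a weaker bound.\<close>
    obtain f' where f': "f' \<in> poly_ring m" "peval x f' = peval x f"
      "\<And>e. e \<in> Poly_Mapping.keys f' \<Longrightarrow> monom_degree e \<le> Polynomial.degree (graded_eval f)"
      using minimal_representative[OF \<open>f \<in> poly_ring m\<close>] by blast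
    have "vge (peval x (pderivative i f') * D (x i))
        ((1 - int (Polynomial.degree (graded_eval f))) + (c - 1))" if i: "i < m" for i
    proof (intro vge_mult vge_peval[where m = m, OF vge_x] poly_ring_pderivative f' D_x i)
      fix e assume "e \<in> Poly_Mapping.keys (pderivative i f')"
      then have "monom_degree (e + Poly_Mapping.single i 1) \<le> Polynomial.degree (graded_eval f)"
        by (intro f'(3) keys_pderivative)
      then show "1 - int (Polynomial.degree (graded_eval f)) \<le> int (monom_degree e) * - 1"
        by (simp add: monom_degree_add)
    qed
    then have "vge (\<Sum>i<m. peval x (pderivative i f') * D (x i)) (c - int (Polynomial.degree (graded_eval f)))"
      by (intro vge_sum) simp
    then show ?thesis
      using derivation_peval[OF D f'(1), of x] f'(2) by simp
  qed
  obtain f g where fg: "f \<in> poly_ring m" "g \<in> poly_ring m" "peval x g \<noteq> 0" "z = peval x f / peval x g"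
    using ex_fraction by blast
  have f_nz: "peval x f \<noteq> 0"
    using z fg by auto
  let ?df = "int (Polynomial.degree (graded_eval f))" and ?dg = "int (Polynomial.degree (graded_eval g))"
  have v_z: "v z = ?dg - ?df"
    using fg f_nz by (simp add: v_fraction)
  have v_g: "v (peval x g) = - ?dg"
    using v_fraction[of g 1] fg by (simp add: graded_eval_def)
  \<comment> \<open>The quotient rule is obtained by applying \<open>D\<close> to the numerator,
    written as \<open>z\<close> times the denominator.\<close>
  have "D (peval x f) = z * D (peval x g) + D z * peval x g"
    using fg derivation_mult[OF D, of z "peval x g"] by simp
  then have "D z = (D (peval x f) - z * D (peval x g)) * inverse (peval x g)"
    using fg(3) by (simp add: field_simps)
  moreover have "vge (z * D (peval x g)) (c - ?df)"
    using vge_mult[OF vge_self[of z] *[OF fg(2)]] by (simp add: v_z)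
  then have "vge ((D (peval x f) - z * D (peval x g)) * inverse (peval x g)) ((c - ?df) + ?dg)"
    using fg(3) by (intro vge_mult vge_diff * fg) (simp_all add: vge_def v_inverse v_g)
  moreover have "v z + c = (c - ?df) + ?dg"
    by (simp add: v_z)
  ultimately show ?thesis
    by (simp only:)
qed

text \<open>As nonzero generators have value -1, the bound \<open>- int n\<close> is the valuation
  inequality on them. The estimate for derivations extends it to all arguments, and a nonzero
  generator shows nontriviality.\<close>

lemma nontrivial_zero_valuations_nonempty:
  assumes "nambu_poisson_algebra scale n br"
    and gen: "\<And>is. length is = n \<Longrightarrow> set is \<subseteq> {..<m} \<Longrightarrow> vge (br (map x is)) (- int n)"
    and i: "i < m" "pvar i \<notin> I"
  shows "nontrivial_zero_valuations n scale br \<noteq> {}"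
proof -
  interpret nambu_poisson_algebra scale n br by fact
  have *: "vge (br us) (\<Sum>s<n. v (us ! s))"
    \<comment> \<open>generators in the slots from \<open>k\<close> on; the other slots are freed one at a time\<close>
    if "length us = n" "\<And>s. s < n \<Longrightarrow> us ! s \<noteq> 0" "\<And>s. k \<le> s \<Longrightarrow> s < n \<Longrightarrow> us ! s \<in> x ` {..<m}" for k us
    using that
  proof (induction k arbitrary: us)
    case 0
    then have "us \<in> lists (x ` {..<m})"
      by (auto simp: in_set_conv_nth)
    then obtain "is" where "is": "us = map x is" "set is \<subseteq> {..<m}"
      unfolding lists_image by auto
    have "v (us ! s) = - 1" if "s < n" for s
      using 0(3)[of s] 0(2)[OF that] v_x that by auto
    then show ?case
      using gen[of "is"] "is" 0(1) by simp
  next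
    case (Suc k)
    show ?case
    proof (cases "k < n")
      case False
      then show ?thesis
        using Suc.prems by (intro Suc.IH) auto
    next
      case k: True
      let ?D = "\<lambda>z. br (us[k := z])"
      \<comment> \<open>The total value of the slots that stay fixed while slot \<open>k\<close>
        varies.\<close>
      define c where "c = (\<Sum>s\<in>{..<n} - {k}. v (us ! s))"
      have sum: "(\<Sum>s<n. v (us[k := z] ! s)) = v z + c" for z
      proof -
        have "(\<Sum>s<n. v (us[k := z] ! s)) = v (us[k := z] ! k) + (\<Sum>s\<in>{..<n} - {k}. v (us[k := z] ! s))"
          using k by (intro sum.remove) auto
        also have "(\<Sum>s\<in>{..<n} - {k}. v (us[k := z] ! s)) = c"
          unfolding c_def by (rule sum.cong) auto
        finally show ?thesis
          using k Suc.prems(1) by simp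
      qed
      have D: "derivation ?D"
        using Suc.prems(1) k by (rule derivation_br)
      have "vge (?D (us ! k)) (v (us ! k) + c)"
      proof (rule vge_derivation[OF D])
        fix i assume i: "i < m"
        show "vge (?D (x i)) (c - 1)"
        proof (cases "x i = 0")
          case True
          then show ?thesis
            using derivation_zero[OF D] by simp
        next
          case False
          have "vge (?D (x i)) (\<Sum>s<n. v (us[k := x i] ! s))"
            using Suc.prems False i k by (intro Suc.IH) (auto simp: nth_list_update)
          then show ?thesis
            using v_x[OF i False] by (simp add: sum)
        qed
      qed (use Suc.prems k in auto)
      then show ?thesis
        using sum[of "us ! k"] by simp
    qed
  qed
  interpret nambu_valuation scale v n br
    by unfold_locales (rule *[of _ n], auto)
  have "x i \<noteq> 0"
    using peval_eq_0_iff[of "pvar i"] i by simp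
  then have "\<not> trivial_valuation (\<lambda>x. if x = 0 then \<infinity> else ereal (real_of_int (v x)))"
    using v_x[OF i(1)] by (auto simp: trivial_valuation_def intro!: exI[of _ "x i"])
  then show ?thesis
    using zero_valuation by (auto simp: nontrivial_zero_valuations_def)
qed

end

text \<open>A multiple of the product of the variables and the constant 1 both have degree at most
  \<open>n\<close>. Other lists of variables reduce to the full list by alternation and
  permutation.\<close>

lemma polynomial_field_nontrivial_valuation:
  fixes scale :: "'k::field_char_0 \<Rightarrow> 'a::field \<Rightarrow> 'a"
  assumes K: "nambu_poisson_algebra scale n br" and n: "n > 0"
    and \<pi>: "fraction_field_via n {0} scale \<pi>"
    and br: "br (map (\<lambda>i. \<pi> (pvar i)) [0..<n]) \<in> {scale q (\<Prod>i<n. \<pi> (pvar i)), 1}"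
  shows "nontrivial_zero_valuations n scale br \<noteq> {}"
proof -
  interpret K: nambu_poisson_algebra scale n br by fact
  interpret graded_fraction_field scale n "{0}" \<pi>
    by unfold_locales (use \<pi> in auto)
  let ?xs = "map x [0..<n]"
  have "vge (\<Prod>i<k. x i) (- int k)" if "k \<le> n" for k
    using that
  proof (induction k)
    case (Suc k)
    then have "vge ((\<Prod>i<k. x i) * x k) (- int k + - 1)"
      by (intro vge_mult vge_x) auto
    moreover have "- int k + - 1 = - int (Suc k)"
      by simp
    ultimately show ?case
      by (simp only: prod.lessThan_Suc)
  qed (simp add: vge_def)
  then have base: "vge (br ?xs) (- int n)"
    using br vge_scale[of "\<Prod>i<n. x i" "- int n" q] by (auto simp: x_def[abs_def] vge_def[of 1])
  show ?thesis
  proof (rule nontrivial_zero_valuations_nonempty[OF K _ n])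
    show "pvar 0 \<notin> {0 :: 'k mpoly}"
      by (auto simp: pvar_def simp flip: keys_eq_empty)
    fix "is" assume "is": "length is = n" "set is \<subseteq> {..<n}"
    show "vge (br (map x is)) (- int n)"
    proof (cases "distinct is")
      case False
      then obtain i j where "i < n" "j < n" "i \<noteq> j" "is ! i = is ! j"
        using "is"(1) by (auto simp: distinct_conv_nth)
      then show ?thesis
        using K.br_alternating[of "map x is" i j] "is"(1) by simp
    next
      case True
      \<comment> \<open>A list of \<open>n\<close> distinct indices below \<open>n\<close> is a
        permutation, extended by the identity as \<open>permutes\<close> demands.\<close>
      define p where "p i = (if i < n then is ! i else i)" for i
      have "bij_betw p {..<n} {..<n}"
      proof -
        have "inj_on p {..<n}"
          using True "is"(1) by (auto simp: inj_on_def p_def nth_eq_iff_index_eq)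
        moreover have "p ` {..<n} \<subseteq> {..<n}"
          using "is" by (auto simp: p_def subset_iff)
        ultimately show ?thesis
          by (simp add: bij_betw_def endo_inj_surj)
      qed
      then have p: "p permutes {..<n}"
        by (rule bij_imp_permutes) (simp add: p_def)
      have "map x is = map (\<lambda>i. ?xs ! p i) [0..<n]"
        using "is" by (intro nth_equalityI) (auto simp: p_def subset_iff)
      then show ?thesis
        using K.br_permute[OF p, of ?xs] base vge_uminus[OF base] by auto
    qed
  qed
qed

text \<open>A principal ideal generated by a form is homogeneous, and since \<Omega> has degree
  \<open>n + 1\<close>, brackets of variables have degree at most \<open>n\<close>.\<close>

lemma Q_P_nontrivial_valuation:
  fixes scale :: "'k::field_char_0 \<Rightarrow> 'a::field \<Rightarrow> 'a"
  assumes n: "n > 0" and \<Omega>: "\<Omega> \<in> poly_ring (n + 1)" "homogeneous_of_degree (n + 1) \<Omega>"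
    and Q: "is_Q_P n \<Omega> 0 scale br"
  shows "nontrivial_zero_valuations n scale br \<noteq> {}"
proof -
  let ?I = "principal_ideal (n + 1) \<Omega>"
  have K: "nambu_poisson_algebra scale n br"
    using Q by (simp add: is_Q_P_def)
  interpret K: nambu_poisson_algebra scale n br by fact
  have "\<Omega> - pconst 0 = \<Omega>"
    by (simp add: pconst_def)
  then obtain \<pi> where \<pi>: "fraction_field_via (n + 1) ?I scale \<pi>"
    and br: "\<And>fs. length fs = n \<Longrightarrow> set fs \<subseteq> poly_ring (n + 1) \<Longrightarrow> br (map \<pi> fs) = \<pi> (jacobian_bracket n \<Omega> fs)"
    using Q by (auto simp: is_Q_P_def)
  have deg: "\<forall>e\<in>Poly_Mapping.keys \<Omega>. monom_degree e = n + 1"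
    using \<Omega>(2) by (simp add: homogeneous_of_degree_iff)
  interpret graded_fraction_field scale "n + 1" ?I \<pi>
  proof unfold_locales
    fix f d assume "f \<in> ?I"
    then obtain h where h: "h \<in> poly_ring (n + 1)" "f = h * \<Omega>"
      by (auto simp: principal_ideal_def)
    show "hpart d f \<in> ?I"
    proof (cases "d < n + 1")
      case True
      then have "hpart d f = 0 * \<Omega>"
        using hpart_mult_less[OF deg] h by simp
      then show ?thesis
        unfolding principal_ideal_def by (intro CollectI exI[of _ 0]) simp
    next
      case False
      then have "hpart d f = hpart (d - (n + 1)) h * \<Omega>"
        using hpart_mult[OF deg, of "d - (n + 1)" h] h by simp
      then show ?thesis
        unfolding principal_ideal_def using h(1) by (auto intro: poly_ring_mpart)
    qed
  qed (rule \<pi>)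
  show ?thesis
  proof (rule nontrivial_zero_valuations_nonempty[OF K])
    show "pvar 0 \<notin> ?I"
    proof
      assume "pvar 0 \<in> ?I"
      then obtain h where "pvar 0 = h * \<Omega>"
        by (auto simp: principal_ideal_def)
      \<comment> \<open>Multiples of \<Omega> have no component of degree 1, because its degree
        \<open>n + 1\<close> is larger.\<close>
      then have "hpart 1 (pvar 0 :: 'k mpoly) = 0"
        using hpart_mult_less[OF deg, of 1 h] n by simp
      then show False
        by (simp add: pvar_def mpart_single flip: keys_eq_empty)
    qed
    fix "is" assume "is": "length is = n" "set is \<subseteq> {..<n + 1}"
    have J: "jacobian_bracket n \<Omega> (map pvar is) \<in> poly_ring (n + 1)"
      "\<And>e. e \<in> Poly_Mapping.keys (jacobian_bracket n \<Omega> (map pvar is)) \<Longrightarrow> monom_degree e \<le> n"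
      using jacobian_bracket_pvar_degree[of \<Omega> n n "is"] \<Omega> "is"(1) by auto
    have "br (map x is) = br (map \<pi> (map pvar is))"
      by (rule arg_cong[of _ _ br]) (simp add: x_def)
    also have "\<dots> = K.peval x (jacobian_bracket n \<Omega> (map pvar is))"
    proof -
      have "set (map pvar is) \<subseteq> (poly_ring (n + 1) :: 'k mpoly set)"
        using "is"(2) by auto
      then show ?thesis
        using br[of "map pvar is"] "is"(1) \<pi>_eq_peval[OF J(1)] by (simp del: map_map)
    qed
    also have "vge \<dots> (- int n)"
      by (rule vge_peval[OF vge_x J(1)]) (use J(2) in auto)
    finally show "vge (br (map x is)) (- int n)" .
  qed simp
qed

theorem corollary5p11:
  fixes n d\<^sub>0 :: nat
    and \<Omega> :: "'k::field_char_0 mpoly"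
    and \<xi> :: 'k
    and scaleN :: "'k \<Rightarrow> 'a::field \<Rightarrow> 'a" and brN :: "'a list \<Rightarrow> 'a"
    and scaleK :: "'k \<Rightarrow> 'b::field \<Rightarrow> 'b" and brK :: "'b list \<Rightarrow> 'b"
  assumes "n \<ge> 3" and "d\<^sub>0 \<ge> 2"
    and "is_potential (n + 1) \<Omega>"
    and "homogeneous_of_degree (n + 1 + d\<^sub>0) \<Omega>"
    and "\<xi> \<noteq> 0"
    and "is_Q_P n \<Omega> \<xi> scaleN brN"
    and "nambu_poisson_algebra scaleK n brK"
    and "comm_algebra.GKdim scaleK = ereal (real n)"
  shows "(nontrivial_zero_valuations n scaleK brK \<noteq> {} \<longrightarrow>
            \<not> (\<exists>\<theta>. nambu_poisson_morphism n scaleN brN scaleK brK \<theta>)) \<and>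
         ((\<exists>q. q \<noteq> 0 \<and> is_N_q n q scaleK brK) \<or>
          is_N_Weyl n scaleK brK \<or>
          (\<exists>\<Omega>\<^sub>0. \<Omega>\<^sub>0 \<in> poly_ring (n + 1) \<and> homogeneous_of_degree (n + 1) \<Omega>\<^sub>0 \<and>
                is_Q_P n \<Omega>\<^sub>0 0 scaleK brK) \<longrightarrow>
            \<not> (\<exists>\<theta>. nambu_poisson_morphism n scaleN brN scaleK brK \<theta>))"
proof -
  have n: "n > 0" and d\<^sub>0: "d\<^sub>0 > 0"
    using assms(1,2) by auto
  have 1: "\<not> (\<exists>\<theta>. nambu_poisson_morphism n scaleN brN scaleK brK \<theta>)"
    if "nontrivial_zero_valuations n scaleK brK \<noteq> {}"
    using no_morphism_if_nontrivial_valuation[OF d\<^sub>0 assms(3-8)] that by blast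
  \<comment> \<open>Each of the three kinds of fields carries a nontrivial 0-valuation, which
    reduces the second part to the first.\<close>
  have "nontrivial_zero_valuations n scaleK brK \<noteq> {}" if "is_N_q n q scaleK brK" for q
    using that polynomial_field_nontrivial_valuation[OF assms(7) n] unfolding is_N_q_def by blast
  moreover have "nontrivial_zero_valuations n scaleK brK \<noteq> {}" if "is_N_Weyl n scaleK brK"
    using that polynomial_field_nontrivial_valuation[OF assms(7) n] unfolding is_N_Weyl_def by blast
  moreover have "nontrivial_zero_valuations n scaleK brK \<noteq> {}"
    if "\<Omega>\<^sub>0 \<in> poly_ring (n + 1)" "homogeneous_of_degree (n + 1) \<Omega>\<^sub>0" "is_Q_P n \<Omega>\<^sub>0 0 scaleK brK" for \<Omega>\<^sub>0
    using that by (rule Q_P_nontrivial_valuation[OF n])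
  ultimately show ?thesis
    using 1 by blast
qed

end
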